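(* Let $X$ be a $T_1$-space. Then the following are equivalent: (1) the mapping $i_2:(X\oplus X_d^{-1}\oplus\{e\})^2\to FP_2(X)$ is a quotient mapping; (2) the mapping $i_2:(X\oplus X_d^{-1}\oplus\{e\})^2\to AP_2(X)$ is a quotient mapping; (3) the mapping $i_2:(X\oplus X_d^{-1}\oplus\{e\})^2\to FP_2(X)$ is a closed mapping; (4) the mapping $i_2:(X\oplus X_d^{-1}\oplus\{e\})^2\to AP_2(X)$ is a closed mapping.
   Context: A paratopological group is a group with a topology (no separation axiom assumed) for which multiplication $G\times G\to G$ is jointly continuous. For a topological space $X$, the (Markov) free paratopological group $FP(X)$ is the paratopological group containing $X$ as a subspace such that $X$ generates $FP(X)$ algebraically and every continuous mapping $f:X\to H$ to a paratopological group $H$ extends to a continuous homomorphism $FP(X)\to H$. The free Abelian paratopological group $AP(X)$ is defined in the same way with all groups Abelian. These exist for every space $X$, and their underlying abstract groups are the free group and the free Abelian group on the set $X$, respectively. The neutral element is denoted $e$. $FP_n(X)$ (resp. $AP_n(X)$) is the subspace of $FP(X)$ (resp. $AP(X)$) of all elements whose reduced length with respect to the basis $X$ is at most $n$. $X_d^{-1}$ is the set $X^{-1}=\{x^{-1}:x\in X\}$ (that is, $-X$ in the Abelian case) with the discrete topology; $\oplus$ denotes topological disjoint sum. The mapping $i_2$ is the multiplication map $i_2(y_1,y_2)=y_1y_2$ (that is, $y_1+y_2$ in the Abelian case), from $(X\oplus X_d^{-1}\oplus\{e\})^2$ with the product topology to $FP_2(X)$ or $AP_2(X)$ as indicated. 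*)

theory Defs
  imports
    "HOL-Analysis.Product_Topology"
    "HOL-Analysis.Sum_Topology"
    "HOL-Analysis.T1_Spaces"
    "HOL-Algebra.Free_Abelian_Groups"
    "HOL-Algebra.Generated_Groups"
begin

section \<open>The free group on a set\<close>

text \<open>The letter \<^term>\<open>(x, True)\<close> stands for the generator \<open>x\<close>, the letter \<^term>\<open>(x, False)\<close>
  for its formal inverse. Elements are the reduced words, so that the reduced length of an element
  is its length as a list.\<close>

definition flip :: "'a \<times> bool \<Rightarrow> 'a \<times> bool" where
  "flip l = (fst l, \<not> snd l)"

definition reduced :: "('a \<times> bool) list \<Rightarrow> bool" where
  "reduced = successively (\<lambda>k l. l \<noteq> flip k)"

definition push :: "'a \<times> bool \<Rightarrow> ('a \<times> bool) list \<Rightarrow> ('a \<times> bool) list" where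
  "push l w = (case w of [] \<Rightarrow> [l] | k # v \<Rightarrow> if k = flip l then v else l # w)"

text \<open>For reduced \<open>u\<close> and \<open>v\<close>, the list \<^term>\<open>foldr push u v\<close> is the reduced form of \<^term>\<open>u @ v\<close>.\<close>

definition free_group :: "'a set \<Rightarrow> ('a \<times> bool) list monoid" where
  "free_group S = \<lparr>carrier = {w. reduced w \<and> fst ` set w \<subseteq> S},
                   monoid.mult = (\<lambda>u v. foldr push u v), one = []\<rparr>"

definition free_gen :: "'a \<Rightarrow> ('a \<times> bool) list" where
  "free_gen x = [(x, True)]"


section \<open>Free paratopological groups\<close>

definition paratopological_group :: "'g monoid \<Rightarrow> 'g topology \<Rightarrow> bool" where
  "paratopological_group G T \<longleftrightarrow> group G \<and> topspace T = carrier G \<and>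
     continuous_map (prod_topology T T) T (\<lambda>(x, y). x \<otimes>\<^bsub>G\<^esub> y)"

text \<open>\<^term>\<open>\<iota>\<close> is the inclusion of the generators, and \<^term>\<open>K\<close> is the class of groups considered:
  \<^const>\<open>group\<close> for \<open>FP(X)\<close>, \<^const>\<open>comm_group\<close> for \<open>AP(X)\<close>. Inside a definition the test groups
  \<open>H\<close> can only range over one type; the lemmas \<open>is_FP_universal\<close> and
  \<open>is_AP_universal\<close> below show that the extension property then holds for test groups of every
  type. The lemmas \<open>is_FP_exists\<close> and \<open>is_AP_exists\<close> show that the topologies described exist
  for every space.\<close>

definition free_paratopological_group ::
  "('g monoid \<Rightarrow> bool) \<Rightarrow> 'a topology \<Rightarrow> ('a \<Rightarrow> 'g) \<Rightarrow> 'g monoid \<Rightarrow> 'g topology \<Rightarrow> bool" where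
  "free_paratopological_group K X \<iota> G T \<longleftrightarrow>
     K G \<and> paratopological_group G T \<and>
     embedding_map X T \<iota> \<and>
     generate G (\<iota> ` topspace X) = carrier G \<and>
     (\<forall>(H :: 'g monoid) S f. K H \<and> paratopological_group H S \<and> continuous_map X S f \<longrightarrow>
        (\<exists>h \<in> hom G H. continuous_map T S h \<and> (\<forall>x \<in> topspace X. h (\<iota> x) = f x)))"

definition is_FP :: "'a topology \<Rightarrow> ('a \<times> bool) list topology \<Rightarrow> bool" where
  "is_FP X T \<longleftrightarrow> free_paratopological_group group X free_gen (free_group (topspace X)) T"

definition is_AP :: "'a topology \<Rightarrow> ('a \<Rightarrow>\<^sub>0 int) topology \<Rightarrow> bool" where
  "is_AP X T \<longleftrightarrow> free_paratopological_group comm_group X frag_of (free_Abelian_group (topspace X)) T"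

definition FP_upto :: "nat \<Rightarrow> 'a topology \<Rightarrow> ('a \<times> bool) list set" where
  "FP_upto n X = {w \<in> carrier (free_group (topspace X)). length w \<le> n}"

definition AP_upto :: "nat \<Rightarrow> 'a topology \<Rightarrow> ('a \<Rightarrow>\<^sub>0 int) set" where
  "AP_upto n X = {a \<in> carrier (free_Abelian_group (topspace X)).
     (\<Sum>x \<in> Poly_Mapping.keys a. nat \<bar>Poly_Mapping.lookup a x\<bar>) \<le> n}"

text \<open>For a copy \<^term>\<open>B\<close> of the space \<open>X\<close> inside a paratopological group, this is
  \<open>X \<oplus> X\<^sub>d\<^sup>-\<^sup>1 \<oplus> {e}\<close>; its points are pairs of the index of a summand and an element of it.\<close>

definition letter_space :: "'g monoid \<Rightarrow> 'g topology \<Rightarrow> 'g set \<Rightarrow> (nat \<times> 'g) topology" where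
  "letter_space G T B =
     sum_topology
       ((!) [subtopology T B, discrete_topology (m_inv G ` B), discrete_topology {\<one>\<^bsub>G\<^esub>}])
       {0, 1, 2}"

definition i2 :: "'g monoid \<Rightarrow> (nat \<times> 'g) \<times> (nat \<times> 'g) \<Rightarrow> 'g" where
  "i2 G = (\<lambda>((_, y1), (_, y2)). y1 \<otimes>\<^bsub>G\<^esub> y2)"

abbreviation FP_letters :: "'a topology \<Rightarrow> ('a \<times> bool) list topology \<Rightarrow> (nat \<times> ('a \<times> bool) list) topology" where
  "FP_letters X T \<equiv> letter_space (free_group (topspace X)) T (free_gen ` topspace X)"

abbreviation AP_letters :: "'a topology \<Rightarrow> ('a \<Rightarrow>\<^sub>0 int) topology \<Rightarrow> (nat \<times> ('a \<Rightarrow>\<^sub>0 int)) topology" where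
  "AP_letters X T \<equiv> letter_space (free_Abelian_group (topspace X)) T (frag_of ` topspace X)"


section \<open>The free group is a group with the universal property\<close>

lemma flip_flip [simp]: "flip (flip l) = l" and fst_flip [simp]: "fst (flip l) = fst l"
  and flip_neq [simp]: "flip l \<noteq> l" "l \<noteq> flip l"
  by (auto simp: flip_def prod_eq_iff)

lemma reduced_simps [simp]: "reduced []" "reduced [l]"
  "reduced (k # l # w) \<longleftrightarrow> l \<noteq> flip k \<and> reduced (l # w)"
  by (auto simp: reduced_def)

lemma reduced_ConsD: "reduced (l # w) \<Longrightarrow> reduced w"
  by (cases w) auto

lemma push_Cons: "push l (k # v) = (if k = flip l then v else l # k # v)"
  by (simp add: push_def)

lemma reduced_push: "reduced w \<Longrightarrow> reduced (push l w)"
  by (auto simp: push_def split: list.splits dest: reduced_ConsD)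

lemma set_push: "set (push l w) \<subseteq> insert l (set w)"
  by (auto simp: push_def split: list.splits)

lemma push_flip: "reduced w \<Longrightarrow> push l (push (flip l) w) = w"
  by (cases w; cases "tl w") (auto simp: push_def)

lemma reduced_foldr_push: "reduced w \<Longrightarrow> reduced (foldr push u w)"
  by (induction u) (auto simp: reduced_push)

lemma set_foldr_push: "set (foldr push u w) \<subseteq> set u \<union> set w"
  by (induction u) (use set_push in fastforce)+

lemma foldr_push_push:
  assumes "reduced w" shows "foldr push (push l v) w = push l (foldr push v w)"
proof (cases v)
  case (Cons k v')
  then show ?thesis
    using push_flip[OF reduced_foldr_push[OF assms], of l v']
    by (cases "k = flip l") (simp_all add: push_Cons)
qed (simp add: push_def[of l "[]"])

lemma foldr_push_assoc:
  "reduced w \<Longrightarrow> foldr push (foldr push u v) w = foldr push u (foldr push v w)"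
  by (induction u) (auto simp: foldr_push_push)

lemma foldr_push_Nil: "reduced w \<Longrightarrow> foldr push w [] = w"
proof (induction w)
  case (Cons l w)
  then have "foldr push w [] = w" by (auto dest: reduced_ConsD)
  moreover have "push l w = l # w" using Cons.prems by (cases w) (simp_all add: push_def)
  ultimately show ?case by simp
qed auto

lemma foldr_push_inverse:
  "reduced w \<Longrightarrow> foldr push (map flip (rev u)) (foldr push u w) = w"
proof (induction u)
  case (Cons l u)
  then show ?case
    using push_flip[OF reduced_foldr_push[OF Cons.prems], of "flip l" u] by simp
qed auto

lemma free_group_simps [simp]:
  "w \<in> carrier (free_group S) \<longleftrightarrow> reduced w \<and> fst ` set w \<subseteq> S"
  "u \<otimes>\<^bsub>free_group S\<^esub> v = foldr push u v"
  "\<one>\<^bsub>free_group S\<^esub> = []"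
  by (auto simp: free_group_def)

lemma group_free_group: "group (free_group S)"
proof (rule groupI)
  fix u v assume "u \<in> carrier (free_group S)" "v \<in> carrier (free_group S)"
  then show "u \<otimes>\<^bsub>free_group S\<^esub> v \<in> carrier (free_group S)"
    using set_foldr_push[of u v] by (fastforce simp: reduced_foldr_push)
next
  fix u assume u: "u \<in> carrier (free_group S)"
  let ?v = "foldr push (map flip (rev u)) []"
  have "foldr push ?v u = foldr push (map flip (rev u)) (foldr push [] u)"
    using u by (intro foldr_push_assoc) auto
  also have "\<dots> = []"
    using foldr_push_inverse[of "[]" u] u by (simp add: foldr_push_Nil)
  finally have "?v \<otimes>\<^bsub>free_group S\<^esub> u = \<one>\<^bsub>free_group S\<^esub>" by simp
  moreover have "?v \<in> carrier (free_group S)"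
    using set_foldr_push[of "map flip (rev u)" "[]"] u by (fastforce simp: reduced_foldr_push)
  ultimately show "\<exists>v\<in>carrier (free_group S). v \<otimes>\<^bsub>free_group S\<^esub> u = \<one>\<^bsub>free_group S\<^esub>"
    by blast
qed (auto simp: foldr_push_assoc)

lemma inv_free_gen:
  "x \<in> S \<Longrightarrow> inv\<^bsub>free_group S\<^esub> free_gen x = [(x, False)]"
  by (rule group.inv_equality[OF group_free_group]) (auto simp: free_gen_def push_def flip_def)

lemma generate_free_gen: "generate (free_group S) (free_gen ` S) = carrier (free_group S)"
proof
  interpret group "free_group S" by (rule group_free_group)
  show "generate (free_group S) (free_gen ` S) \<subseteq> carrier (free_group S)"
    by (rule generate_incl) (auto simp: free_gen_def)
  have "w \<in> generate (free_group S) (free_gen ` S)" if "reduced w" "fst ` set w \<subseteq> S" for w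
    using that
  proof (induction w)
    case Nil
    then show ?case using generate.one[of "free_group S"] by simp
  next
    case (Cons l w)
    obtain x b where l: "l = (x, b)" by (cases l)
    have x: "x \<in> S" using Cons.prems l by auto
    have "[l] \<in> generate (free_group S) (free_gen ` S)"
      using generate.incl[of "free_gen x" "free_gen ` S" "free_group S"]
        generate.inv[of "free_gen x" "free_gen ` S" "free_group S"] x inv_free_gen[OF x]
      by (cases b) (auto simp: l free_gen_def)
    moreover have "w \<in> generate (free_group S) (free_gen ` S)"
      using Cons by (auto dest: reduced_ConsD)
    ultimately have "[l] \<otimes>\<^bsub>free_group S\<^esub> w \<in> generate (free_group S) (free_gen ` S)"
      by (rule generate.eng)
    then show ?case
      using Cons.prems by (cases w) (auto simp: push_def)
  qed
  then show "carrier (free_group S) \<subseteq> generate (free_group S) (free_gen ` S)"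
    by auto
qed

lemma free_group_universal:
  assumes "group H" and f: "f \<in> S \<rightarrow> carrier H"
  shows "\<exists>h \<in> hom (free_group S) H. \<forall>x\<in>S. h (free_gen x) = f x"
proof -
  interpret H: group H by fact
  define g where "g l = (if snd l then f (fst l) else inv\<^bsub>H\<^esub> f (fst l))" for l
  define h where "h w = foldr (\<lambda>l y. g l \<otimes>\<^bsub>H\<^esub> y) w \<one>\<^bsub>H\<^esub>" for w
  have g: "g l \<in> carrier H" if "fst l \<in> S" for l
    using f that by (auto simp: g_def)
  have gflip: "g l \<otimes>\<^bsub>H\<^esub> g (flip l) = \<one>\<^bsub>H\<^esub>" if "fst l \<in> S" for l
    using f that by (cases l) (auto simp: g_def flip_def Pi_iff)
  have h_simps [simp]: "h [] = \<one>\<^bsub>H\<^esub>" "h (l # w) = g l \<otimes>\<^bsub>H\<^esub> h w" for l w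
    by (auto simp: h_def)
  have h: "h w \<in> carrier H" if "fst ` set w \<subseteq> S" for w
    using that by (induction w) (auto simp: g)
  have push: "h (push l w) = g l \<otimes>\<^bsub>H\<^esub> h w" if "fst l \<in> S" "fst ` set w \<subseteq> S" for l w
  proof (cases "\<exists>v. w = flip l # v")
    case True
    then obtain v where w: "w = flip l # v" by auto
    have v: "h v \<in> carrier H" using that w by (intro h) auto
    have "g l \<otimes>\<^bsub>H\<^esub> h w = (g l \<otimes>\<^bsub>H\<^esub> g (flip l)) \<otimes>\<^bsub>H\<^esub> h v"
      using that v by (simp add: w H.m_assoc g)
    then show ?thesis using that v by (simp add: w push_def gflip)
  qed (auto simp: push_def split: list.splits)
  have mult: "h (foldr push u w) = h u \<otimes>\<^bsub>H\<^esub> h w" if "fst ` set u \<subseteq> S" "fst ` set w \<subseteq> S" for u w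
    using that
  proof (induction u)
    case (Cons l u)
    have "fst ` set (foldr push u w) \<subseteq> S"
      using set_foldr_push[of u w] Cons.prems by fastforce
    then show ?case using Cons by (simp add: push g h H.m_assoc)
  qed (auto simp: h)
  have "h \<in> hom (free_group S) H"
    by (rule homI) (auto simp: h mult)
  moreover have "h (free_gen x) = f x" if "x \<in> S" for x
    using that f by (auto simp: free_gen_def g_def Pi_iff)
  ultimately show ?thesis by blast
qed


section \<open>Existence and the universal property for test groups of arbitrary type\<close>

lemma paratopological_group_pullback:
  assumes "group G" "paratopological_group H S" "h \<in> hom G H"
  shows "paratopological_group G (pullback_topology (carrier G) h S)" (is "paratopological_group G ?T")
proof -
  interpret group G by fact
  have S: "topspace S = carrier H" and mS: "continuous_map (prod_topology S S) S (\<lambda>(x, y). x \<otimes>\<^bsub>H\<^esub> y)"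
    using assms by (auto simp: paratopological_group_def)
  have T: "topspace ?T = carrier G"
    using assms(3) S by (auto simp: topspace_pullback_topology hom_def)
  have h: "continuous_map ?T S h"
    using continuous_map_pullback[OF continuous_map_id, of "carrier G" h S] by (simp add: o_def)
  have "continuous_map (prod_topology ?T ?T) S (\<lambda>p. (\<lambda>(x, y). x \<otimes>\<^bsub>H\<^esub> y) (h (fst p), h (snd p)))"
    by (intro continuous_map_compose[OF _ mS, unfolded o_def] continuous_map_pairedI
        continuous_map_compose[OF continuous_map_fst h, unfolded o_def]
        continuous_map_compose[OF continuous_map_snd h, unfolded o_def])
  then have "continuous_map (prod_topology ?T ?T) S (h \<circ> (\<lambda>(x, y). x \<otimes>\<^bsub>G\<^esub> y))"
    by (rule continuous_map_eq) (use assms(3) T in \<open>auto simp: hom_def\<close>)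
  then have "continuous_map (prod_topology ?T ?T) ?T (\<lambda>(x, y). x \<otimes>\<^bsub>G\<^esub> y)"
    by (rule continuous_map_pullback') (auto simp: T)
  with T show ?thesis
    using assms by (auto simp: paratopological_group_def)
qed

lemma hom_eq_on_generate:
  assumes "group G" "group H" "h \<in> hom G H" "k \<in> hom G H" "A \<subseteq> carrier G"
    and "\<And>x. x \<in> A \<Longrightarrow> h x = k x" and "y \<in> generate G A"
  shows "h y = k y"
proof -
  interpret G: group G by fact
  interpret h: group_hom G H h using assms by (simp add: group_hom_def group_hom_axioms_def)
  interpret k: group_hom G H k using assms by (simp add: group_hom_def group_hom_axioms_def)
  show ?thesis
    using assms(7)
  proof induction
    case (inv x)
    with assms have "x \<in> carrier G" by auto
    then show ?case using assms(6)[OF inv] by simp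
  next
    case (eng x y)
    then have "x \<in> carrier G" "y \<in> carrier G" using G.generate_incl[OF assms(5)] by auto
    with eng show ?case by simp
  qed (use assms in auto)
qed

lemma free_paratopological_group_continuous:
  fixes G :: "'g monoid" and H :: "'h monoid"
  assumes T: "free_paratopological_group K X \<iota> G T" and H: "paratopological_group H S"
    and f: "continuous_map X S f"
    and h: "h \<in> hom G H" "\<And>x. x \<in> topspace X \<Longrightarrow> h (\<iota> x) = f x"
  shows "continuous_map T S h"
proof -
  let ?P = "pullback_topology (carrier G) h S"
  have G: "K G" "group G" "topspace T = carrier G" and gen: "generate G (\<iota> ` topspace X) = carrier G"
    using T by (auto simp: free_paratopological_group_def paratopological_group_def)
  have sub: "\<iota> ` topspace X \<subseteq> carrier G"
    using gen generate.incl[of _ "\<iota> ` topspace X" G] by auto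
  have P: "paratopological_group G ?P"
    by (rule paratopological_group_pullback) (use G H h in auto)
  have "continuous_map X S (h \<circ> \<iota>)"
    using f by (rule continuous_map_eq) (simp add: h)
  then have "continuous_map X ?P \<iota>"
    by (rule continuous_map_pullback') (use sub in auto)
  then have "\<exists>k\<in>hom G G. continuous_map T ?P k \<and> (\<forall>x\<in>topspace X. k (\<iota> x) = \<iota> x)"
    using T G(1) P unfolding free_paratopological_group_def by simp
  then obtain k where k: "k \<in> hom G G" "continuous_map T ?P k"
      and kx: "\<And>x. x \<in> topspace X \<Longrightarrow> k (\<iota> x) = \<iota> x"
    by auto
  have ky: "k y = y" if "y \<in> carrier G" for y
  proof -
    have "(\<lambda>z. z) \<in> hom G G" by (simp add: hom_def)
    then show ?thesis
      by (rule hom_eq_on_generate[OF G(2) G(2) k(1) _ sub]) (use kx that gen in auto)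
  qed
  have "continuous_map T ?P id"
    by (rule continuous_map_eq[OF k(2)]) (simp add: G ky)
  moreover have "continuous_map ?P S (id \<circ> h)"
    by (rule continuous_map_pullback) (rule continuous_map_id)
  ultimately show ?thesis
    using continuous_map_compose by fastforce
qed

definition upset_topology :: "int topology" where
  "upset_topology = topology (\<lambda>U. \<forall>a \<in> U. \<forall>b \<ge> a. b \<in> U)"

lemma openin_upset_topology: "openin upset_topology U \<longleftrightarrow> (\<forall>a \<in> U. \<forall>b \<ge> a. b \<in> U)"
proof -
  have "istopology (\<lambda>U :: int set. \<forall>a \<in> U. \<forall>b \<ge> a. b \<in> U)"
    unfolding istopology_def by blast
  then show ?thesis by (simp add: upset_topology_def)
qed

lemma topspace_upset_topology [simp]: "topspace upset_topology = UNIV"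
  using openin_subset[of upset_topology UNIV] by (auto simp: openin_upset_topology)

lemma paratopological_group_upset: "paratopological_group integer_group upset_topology"
proof -
  have "openin (prod_topology upset_topology upset_topology) {p. fst p + snd p \<in> U}"
    if U: "openin upset_topology U" for U
    unfolding openin_prod_topology_alt
  proof (intro allI impI)
    fix x y assume "(x, y) \<in> {p. fst p + snd p \<in> U}"
    then show "\<exists>V W. openin upset_topology V \<and> openin upset_topology W \<and> x \<in> V \<and> y \<in> W \<and>
        V \<times> W \<subseteq> {p. fst p + snd p \<in> U}"
      using U by (intro exI[of _ "{x..}"] exI[of _ "{y..}"])
        (auto simp: openin_upset_topology dest!: bspec intro: add_mono)
  qed
  then show ?thesis
    by (auto simp: paratopological_group_def continuous_map_def integer_group_def case_prod_beta
        group_integer_group[unfolded integer_group_def])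
qed

lemma free_paratopological_group_exists:
  fixes G :: "'g monoid" and X :: "'a topology"
  assumes "group G" "K G" and gen: "generate G (\<iota> ` topspace X) = carrier G"
    and ext: "\<And>(H :: 'g monoid) f. \<lbrakk>group H; K H; f \<in> topspace X \<rightarrow> carrier H\<rbrakk> \<Longrightarrow>
      \<exists>h \<in> hom G H. \<forall>x \<in> topspace X. h (\<iota> x) = f x"
    and extZ: "\<And>f. \<exists>h \<in> hom G integer_group. \<forall>x \<in> topspace X. h (\<iota> x) = f x"
  shows "\<exists>T. free_paratopological_group K X \<iota> G T"
proof -
  define good where "good = {T. paratopological_group G T \<and> continuous_map X T \<iota>}"
  define B where "B = (\<Union>T\<in>good. {U. openin T U})"
  define T where "T = topology_generated_by B"
  have sub: "\<iota> x \<in> carrier G" if "x \<in> topspace X" for x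
    using gen generate.incl[of "\<iota> x" "\<iota> ` topspace X" G] that by auto
  have pull: "pullback_topology (carrier G) h S \<in> good"
    if "paratopological_group H S" "h \<in> hom G H" "continuous_map X S f"
      "\<And>x. x \<in> topspace X \<Longrightarrow> h (\<iota> x) = f x" for h f S and H :: "'h monoid"
  proof -
    have "continuous_map X S (h \<circ> \<iota>)"
      using that(3) by (rule continuous_map_eq) (simp add: that)
    then have "continuous_map X (pullback_topology (carrier G) h S) \<iota>"
      by (rule continuous_map_pullback') (use sub in auto)
    then show ?thesis
      using paratopological_group_pullback[OF assms(1) that(1,2)] by (simp add: good_def)
  qed
  have sep: "\<exists>S \<in> good. \<exists>V. openin S V \<and> (\<forall>x\<in>topspace X. \<iota> x \<in> V \<longleftrightarrow> x \<in> U)" if U: "openin X U" for U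
  proof -
    define f where "f x = (if x \<in> U then 1 else 0 :: int)" for x
    obtain h where h: "h \<in> hom G integer_group" "\<And>x. x \<in> topspace X \<Longrightarrow> h (\<iota> x) = f x"
      using extZ[of f] by blast
    have f: "continuous_map X upset_topology f"
      unfolding continuous_map_def
    proof (intro conjI allI impI)
      fix W assume W: "openin upset_topology W"
      have "0 \<in> W \<Longrightarrow> 1 \<in> W"
        using W by (force simp: openin_upset_topology)
      then have "{x \<in> topspace X. f x \<in> W} = (if 0 \<in> W then topspace X else if 1 \<in> W then U else {})"
        using openin_subset[OF U] by (auto simp: f_def)
      then show "openin X {x \<in> topspace X. f x \<in> W}"
        using U by simp
    qed auto
    have "openin (pullback_topology (carrier G) h upset_topology) (h -` {1..} \<inter> carrier G)"
      unfolding openin_pullback_topology by (intro exI[of _ "{1..}"]) (auto simp: openin_upset_topology)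
    moreover have "\<iota> x \<in> h -` {1..} \<inter> carrier G \<longleftrightarrow> x \<in> U" if "x \<in> topspace X" for x
      using that by (auto simp: h f_def sub)
    ultimately show ?thesis
      using pull[OF paratopological_group_upset h(1) f h(2)] by blast
  qed
  have top: "topspace S = carrier G" if "S \<in> good" for S
    using that by (auto simp: good_def paratopological_group_def)
  have fine: "openin T U" if "S \<in> good" "openin S U" for S U
    unfolding T_def by (rule topology_generated_by_Basis) (use that in \<open>auto simp: B_def\<close>)
  obtain S0 where S0: "S0 \<in> good" using sep[OF openin_empty] by blast
  have topT: "topspace T = carrier G"
  proof -
    have "topspace T = \<Union>B" by (simp add: T_def)
    also have "\<dots> = carrier G"
      using S0 top openin_subset openin_topspace unfolding B_def by fastforce
    finally show ?thesis .
  qed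
  have id: "continuous_map T S id" if "S \<in> good" for S
    unfolding continuous_map_def
  proof (intro conjI allI impI)
    fix U assume U: "openin S U"
    then have "{x \<in> topspace T. id x \<in> U} = U"
      using openin_subset[OF U] by (auto simp: top[OF that] topT)
    then show "openin T {x \<in> topspace T. id x \<in> U}"
      using fine[OF that U] by simp
  qed (simp add: topT top[OF that])
  have T_continuous: "continuous_map Y T g"
    if "\<And>S. S \<in> good \<Longrightarrow> continuous_map Y S g" for Y :: "'b topology" and g
    unfolding T_def
  proof (rule continuous_on_generated_topo)
    fix U assume "U \<in> B"
    then obtain S where "S \<in> good" "openin S U" by (auto simp: B_def)
    then show "openin Y (g -` U \<inter> topspace Y)"
      using that[of S] by (auto simp: continuous_map_alt)
  next
    show "g ` topspace Y \<subseteq> \<Union>B"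
      using that[OF S0] topT top[OF S0] by (auto simp: T_def continuous_map_def)
  qed
  have "continuous_map (prod_topology T T) T (\<lambda>(x, y). x \<otimes>\<^bsub>G\<^esub> y)"
  proof (rule T_continuous)
    fix S assume S: "S \<in> good"
    have "continuous_map (prod_topology T T) (prod_topology S S) (\<lambda>(x, y). (id x, id y))"
      using id[OF S] by (simp only: continuous_map_prod_top) simp
    moreover have "continuous_map (prod_topology S S) S (\<lambda>(x, y). x \<otimes>\<^bsub>G\<^esub> y)"
      using S by (auto simp: good_def paratopological_group_def)
    ultimately show "continuous_map (prod_topology T T) S (\<lambda>(x, y). x \<otimes>\<^bsub>G\<^esub> y)"
      by (drule_tac continuous_map_compose) (auto simp: o_def case_prod_unfold)
  qed
  then have para: "paratopological_group G T"
    using assms topT by (simp add: paratopological_group_def)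
  have cont: "continuous_map X T \<iota>"
    by (rule T_continuous) (simp add: good_def)
  have "inj_on \<iota> (topspace X)"
  proof (rule inj_onI)
    fix x y assume xy: "x \<in> topspace X" "y \<in> topspace X" "\<iota> x = \<iota> y"
    obtain h :: "'g \<Rightarrow> int" where "\<forall>z\<in>topspace X. h (\<iota> z) = (if z = x then 1 else 0)"
      using extZ[of "\<lambda>z. if z = x then 1 else 0"] by auto
    with xy have "(if y = x then 1 else 0 :: int) = 1" by metis
    then show "x = y" by (simp split: if_splits)
  qed
  moreover have "open_map X (subtopology T (\<iota> ` topspace X)) \<iota>"
    unfolding open_map_def
  proof (intro allI impI)
    fix U assume U: "openin X U"
    then obtain S V where "S \<in> good" "openin S V" and V: "\<forall>x\<in>topspace X. \<iota> x \<in> V \<longleftrightarrow> x \<in> U"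
      using sep by blast
    then have "openin T V" using fine by blast
    moreover have "\<iota> ` U = V \<inter> \<iota> ` topspace X"
      using V openin_subset[OF U] by auto
    ultimately show "openin (subtopology T (\<iota> ` topspace X)) (\<iota> ` U)"
      by (auto simp: openin_subtopology)
  qed
  ultimately have emb: "embedding_map X T \<iota>"
    using cont topT sub unfolding embedding_map_def
    by (intro bijective_open_imp_homeomorphic_map) (auto simp: continuous_map_in_subtopology)
  have "\<exists>h \<in> hom G H. continuous_map T S h \<and> (\<forall>x \<in> topspace X. h (\<iota> x) = f x)"
    if H: "K H" "paratopological_group H S" "continuous_map X S f" for H :: "'g monoid" and S f
  proof -
    have "f \<in> topspace X \<rightarrow> carrier H" "group H"
      using H by (auto simp: paratopological_group_def continuous_map_def)
    then obtain h where h: "h \<in> hom G H" "\<And>x. x \<in> topspace X \<Longrightarrow> h (\<iota> x) = f x"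
      using ext H by blast
    have "continuous_map T S (h \<circ> id)"
      by (rule continuous_map_compose[OF id[OF pull[OF H(2) h(1) H(3) h(2)]]])
        (use continuous_map_pullback[OF continuous_map_id, of "carrier G" h S] in \<open>simp_all add: o_def\<close>)
    with h show ?thesis by auto
  qed
  then have "free_paratopological_group K X \<iota> G T"
    unfolding free_paratopological_group_def
    by (intro conjI allI impI para emb gen \<open>K G\<close>) simp
  then show ?thesis ..
qed

lemma is_FP_exists: "\<exists>T. is_FP X T"
  unfolding is_FP_def
  by (rule free_paratopological_group_exists)
    (simp_all add: group_free_group generate_free_gen free_group_universal Pi_iff integer_group_def[abs_def]
      group_integer_group[unfolded integer_group_def])

lemma is_FP_universal:
  assumes "is_FP X T" "paratopological_group H S" "continuous_map X S f"
  shows "\<exists>h \<in> hom (free_group (topspace X)) H. continuous_map T S h \<and>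
           (\<forall>x \<in> topspace X. h (free_gen x) = f x)"
proof -
  have "group H" "f \<in> topspace X \<rightarrow> carrier H"
    using assms by (auto simp: paratopological_group_def continuous_map_def)
  from free_group_universal[OF this] show ?thesis
    using free_paratopological_group_continuous[OF assms(1)[unfolded is_FP_def] assms(2,3)] by blast
qed

lemma generate_frag_of:
  "generate (free_Abelian_group S) (frag_of ` S) = carrier (free_Abelian_group S)"
proof
  interpret group "free_Abelian_group S" by simp
  show "generate (free_Abelian_group S) (frag_of ` S) \<subseteq> carrier (free_Abelian_group S)"
    by (rule generate_incl) auto
  show "carrier (free_Abelian_group S) \<subseteq> generate (free_Abelian_group S) (frag_of ` S)"
  proof
    fix a assume "a \<in> carrier (free_Abelian_group S)"
    then have a: "Poly_Mapping.keys a \<subseteq> S" by simp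
    have sg: "subgroup (generate (free_Abelian_group S) (frag_of ` S)) (free_Abelian_group S)"
      by (rule generate_is_subgroup) auto
    from a have "a \<in> generate (free_Abelian_group S) (frag_of ` S) \<and> Poly_Mapping.keys a \<subseteq> S"
    proof (induction a rule: frag_induction)
      case zero
      then show ?case using subgroup.one_closed[OF sg] by simp
    next
      case (one x)
      then show ?case by (auto intro: generate.incl)
    next
      case (diff a b)
      then have "a \<otimes>\<^bsub>free_Abelian_group S\<^esub> inv\<^bsub>free_Abelian_group S\<^esub> b
          \<in> generate (free_Abelian_group S) (frag_of ` S)"
        by (intro subgroup.m_closed[OF sg] subgroup.m_inv_closed[OF sg]) auto
      then show ?case using diff keys_diff[of a b] by auto
    qed
    then show "a \<in> generate (free_Abelian_group S) (frag_of ` S)" ..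
  qed
qed

lemma free_Abelian_group_universal':
  assumes "comm_group H" "f \<in> S \<rightarrow> carrier H"
  shows "\<exists>h \<in> hom (free_Abelian_group S) H. \<forall>x\<in>S. h (frag_of x) = f x"
proof -
  from assms(2) have "f ` S \<subseteq> carrier H" by auto
  from comm_group.free_Abelian_group_universal[OF assms(1) this] show ?thesis by metis
qed

lemma is_AP_exists: "\<exists>T. is_AP X T"
proof -
  have "comm_group integer_group"
    by (rule group.group_comm_groupI) (auto simp: integer_group_def[abs_def] group_integer_group[unfolded integer_group_def])
  then show ?thesis
    unfolding is_AP_def
    by (intro free_paratopological_group_exists free_Abelian_group_universal')
      (auto simp: generate_frag_of abelian_free_Abelian_group integer_group_def)
qed

lemma is_AP_universal:
  assumes "is_AP X T" "comm_group H" "paratopological_group H S" "continuous_map X S f"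
  shows "\<exists>h \<in> hom (free_Abelian_group (topspace X)) H. continuous_map T S h \<and>
           (\<forall>x \<in> topspace X. h (frag_of x) = f x)"
proof -
  have "f \<in> topspace X \<rightarrow> carrier H"
    using assms by (auto simp: continuous_map_def paratopological_group_def)
  from free_Abelian_group_universal'[OF assms(2) this] show ?thesis
    using free_paratopological_group_continuous[OF assms(1)[unfolded is_AP_def] assms(3,4)] by blast
qed

end

theory Submission
  imports Defs
begin

text \<open>All four conditions are equivalent to every neighbournet of \<open>X\<close> being normal: for every assignment of
  open neighbourhoods \<open>V(x)\<close> there is one with \<open>W \<circ> W \<subseteq> V\<close>. If \<open>i\<^sub>2\<close> is quotient, then \<open>e\<close> together with the words
  \<open>t\<^sup>-\<^sup>1z\<close> and \<open>zt\<^sup>-\<^sup>1\<close>, \<open>z \<in> V(t)\<close>, is an open set of words of length at most two, and halving a neighbourhood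
  of \<open>e\<close> inducing it yields \<open>W\<close>. Conversely, a closed map is one for which every neighbourhood of a fibre contains
  the preimage of a neighbourhood of the point. For the point \<open>e\<close>, a normal sequence starting with \<open>V\<close> gives,
  by the chain argument for metrization of uniform spaces, a family of functions \<open>f\<close> that is equi-upper
  semicontinuous and such that \<open>f(y) < f(x) + 1\<close> for all \<open>f\<close> implies \<open>y \<in> V(x)\<close>; extending all \<open>f\<close> simultaneously
  to homomorphisms into the reals gives the neighbourhood of \<open>e\<close>. For every other word, indicators of closed sets
  determine the two letters up to their order, using \<open>T\<^sub>1\<close> for the inverse letters. In the non-Abelian case the
  order is recovered from homomorphisms to a free group on two generators.\<close>

section \<open>Neighbourhood assignments\<close>

definition nbhd_assignment :: "'a topology \<Rightarrow> ('a \<Rightarrow> 'a set) \<Rightarrow> bool" where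
  "nbhd_assignment X V \<longleftrightarrow> (\<forall>x \<in> topspace X. openin X (V x) \<and> x \<in> V x)"

text \<open>Every neighbournet of \<open>X\<close> is normal. Nothing is required of \<^term>\<open>V x\<close> for points outside the space.\<close>

definition all_normal :: "'a topology \<Rightarrow> bool" where
  "all_normal X \<longleftrightarrow> (\<forall>V. nbhd_assignment X V \<longrightarrow>
     (\<exists>W. nbhd_assignment X W \<and> (\<forall>x \<in> topspace X. \<forall>y \<in> W x. W y \<subseteq> V x)))"

text \<open>One neighbourhood has to serve the whole family, because the family will be used as a
  single map into a function space. Values are bounded only from above, matching test groups in
  which inversion need not be continuous.\<close>

definition equi_usc :: "'a topology \<Rightarrow> ('a \<Rightarrow> real) set \<Rightarrow> bool" where
  "equi_usc X F \<longleftrightarrow> (\<forall>x \<in> topspace X. \<forall>\<epsilon>>0. \<exists>A. openin X A \<and> x \<in> A \<and> (\<forall>f \<in> F. \<forall>y \<in> A. f y < f x + \<epsilon>))"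

lemma equi_usc_empty: "equi_usc X {}"
  by (auto simp: equi_usc_def)

lemma equi_usc_Un:
  assumes "equi_usc X F" "equi_usc X G" shows "equi_usc X (F \<union> G)"
  unfolding equi_usc_def
proof (intro ballI allI impI)
  fix x and \<epsilon> :: real assume "x \<in> topspace X" "0 < \<epsilon>"
  with assms obtain A B where "openin X A" "x \<in> A" "\<forall>f\<in>F. \<forall>y\<in>A. f y < f x + \<epsilon>"
    "openin X B" "x \<in> B" "\<forall>f\<in>G. \<forall>y\<in>B. f y < f x + \<epsilon>"
    unfolding equi_usc_def by meson
  then show "\<exists>A. openin X A \<and> x \<in> A \<and> (\<forall>f\<in>F \<union> G. \<forall>y\<in>A. f y < f x + \<epsilon>)"
    by (intro exI[of _ "A \<inter> B"]) auto
qed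

lemma equi_usc_insert: "equi_usc X {f} \<Longrightarrow> equi_usc X F \<Longrightarrow> equi_usc X (insert f F)"
  using equi_usc_Un[of X "{f}" F] by simp

lemma equi_usc_const: "equi_usc X {\<lambda>_. c}"
  by (auto simp: equi_usc_def)

text \<open>Off the closed set, its complement is a neighbourhood on which the value stays 0; on the
  set, the value 1 is already maximal.\<close>

lemma equi_usc_closed:
  assumes "closedin X C" shows "equi_usc X {indicator C}"
  unfolding equi_usc_def
proof (intro ballI allI impI)
  fix x and \<epsilon> :: real assume x: "x \<in> topspace X" "0 < \<epsilon>"
  show "\<exists>A. openin X A \<and> x \<in> A \<and> (\<forall>f\<in>{indicator C}. \<forall>y\<in>A. f y < f x + \<epsilon>)"
  proof (cases "x \<in> C")
    case True
    with x show ?thesis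
      by (intro exI[of _ "topspace X"]) (auto simp: indicator_def)
  next
    case False
    with x assms show ?thesis
      by (intro exI[of _ "topspace X - C"]) (auto simp: indicator_def)
  qed
qed

lemma nbhd_assignmentD:
  "nbhd_assignment X V \<Longrightarrow> x \<in> topspace X \<Longrightarrow> x \<in> V x"
  "nbhd_assignment X V \<Longrightarrow> x \<in> topspace X \<Longrightarrow> y \<in> V x \<Longrightarrow> y \<in> topspace X"
  using openin_subset by (fastforce simp: nbhd_assignment_def)+

text \<open>Halving twice covers four steps; with a trivial step at \<open>z\<close> this leaves the
  three that the chain argument consumes.\<close>

lemma nbhd_assignment_cube:
  assumes "all_normal X" "nbhd_assignment X V"
  obtains W where "nbhd_assignment X W"
    "\<And>x y z u. \<lbrakk>x \<in> topspace X; y \<in> W x; z \<in> W y; u \<in> W z\<rbrakk> \<Longrightarrow> u \<in> V x"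
proof -
  from assms obtain W where W: "nbhd_assignment X W" "\<forall>x \<in> topspace X. \<forall>y \<in> W x. W y \<subseteq> V x"
    unfolding all_normal_def by blast
  with assms obtain W' where W': "nbhd_assignment X W'" "\<forall>x \<in> topspace X. \<forall>y \<in> W' x. W' y \<subseteq> W x"
    unfolding all_normal_def by blast
  have "u \<in> V x" if "x \<in> topspace X" "y \<in> W' x" "z \<in> W' y" "u \<in> W' z" for x y z u
  proof -
    have z: "z \<in> W x" using that W' by blast
    then have "z \<in> topspace X" using W(1) that(1) nbhd_assignmentD by metis
    then have "u \<in> W z" using that W' nbhd_assignmentD(1)[OF W'(1), of z] by blast
    then show "u \<in> V x" using W z that by blast
  qed
  with W' that show thesis by blast
qed

section \<open>Chains through a normal sequence of neighbournets\<close>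

fun chain :: "(nat \<Rightarrow> 'a \<Rightarrow> 'a set) \<Rightarrow> nat list \<Rightarrow> 'a \<Rightarrow> 'a \<Rightarrow> bool" where
  "chain V [] x z \<longleftrightarrow> x = z" |
  "chain V (n # ns) x z \<longleftrightarrow> (\<exists>y \<in> V n x. chain V ns y z)"

text \<open>Links at level \<open>n\<close> have length 2^-n, as in the pseudometric built from a
  countable base of entourages; chains are directed here, so no symmetry results.\<close>

definition chain_weight :: "nat list \<Rightarrow> real" where
  "chain_weight ns = (\<Sum>n\<leftarrow>ns. (1/2) ^ n)"

lemma chain_append: "chain V (ms @ ns) x z \<longleftrightarrow> (\<exists>y. chain V ms x y \<and> chain V ns y z)"
  by (induction ms arbitrary: x) auto

lemma chain_weight_simps [simp]:
  "chain_weight [] = 0" "chain_weight (n # ns) = (1/2) ^ n + chain_weight ns"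
  "chain_weight (ms @ ns) = chain_weight ms + chain_weight ns"
  by (auto simp: chain_weight_def)

lemma chain_weight_nonneg: "0 \<le> chain_weight ns"
  by (induction ns) auto

text \<open>The link \<open>m\<close> is the one during which the running weight passes
  \<open>r\<close>: the part before it weighs at most \<open>r\<close>, the part after it less than
  the total minus \<open>r\<close>.\<close>

lemma chain_weight_split:
  assumes "0 \<le> r" "r < chain_weight ns"
  obtains as m bs where "ns = as @ m # bs" "chain_weight as \<le> r" "r < chain_weight as + (1/2) ^ m"
proof -
  have "\<exists>as m bs. ns = as @ m # bs \<and> chain_weight as \<le> r \<and> r < chain_weight as + (1/2) ^ m"
    using assms
  proof (induction ns arbitrary: r)
    case (Cons n ns)
    show ?case
    proof (cases "r < (1/2) ^ n")
      case True
      then show ?thesis using Cons.prems by (intro exI[of _ "[]"]) auto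
    next
      case False
      then obtain as m bs where "ns = as @ m # bs" "chain_weight as \<le> r - (1/2) ^ n"
        "r - (1/2) ^ n < chain_weight as + (1/2) ^ m"
        using Cons.IH[of "r - (1/2) ^ n"] Cons.prems by auto
      then show ?thesis
        by (intro exI[of _ "n # as"] exI[of _ m] exI[of _ bs]) auto
    qed
  qed auto
  with that show thesis by blast
qed

text \<open>The directed analogue of a countable base of entourages, indexed so that three steps of
  level n + 1 fit into one step of level n.\<close>

locale normal_sequence =
  fixes X :: "'a topology" and V :: "nat \<Rightarrow> 'a \<Rightarrow> 'a set"
  assumes nbhd: "nbhd_assignment X (V n)"
    and cube: "\<lbrakk>x \<in> topspace X; y \<in> V (Suc n) x; z \<in> V (Suc n) y; u \<in> V (Suc n) z\<rbrakk> \<Longrightarrow> u \<in> V n x"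
begin

lemma in_topspace: "x \<in> topspace X \<Longrightarrow> y \<in> V n x \<Longrightarrow> y \<in> topspace X"
  using nbhd nbhd_assignmentD(2) by metis

lemma refl: "x \<in> topspace X \<Longrightarrow> x \<in> V n x"
  using nbhd nbhd_assignmentD(1) by metis

lemma mono: "x \<in> topspace X \<Longrightarrow> n \<le> m \<Longrightarrow> y \<in> V m x \<Longrightarrow> y \<in> V n x"
proof (induction "m - n" arbitrary: m)
  case (Suc k)
  then obtain m' where m: "m = Suc m'" by (cases m) auto
  \<comment> \<open>Two trivial steps at \<open>x\<close> are put in front of the step to
    \<open>y\<close>.\<close>
  have "y \<in> V m' x"
    using cube[of x x m' x y] refl[OF Suc.prems(1)] Suc.prems by (simp add: m)
  then show ?case using Suc(1)[of m'] Suc(2-) by (simp add: m)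
qed auto

lemma chain_in_topspace: "chain V ns x z \<Longrightarrow> x \<in> topspace X \<Longrightarrow> z \<in> topspace X"
  by (induction ns arbitrary: x) (auto dest: in_topspace)

text \<open>The chain argument of the metrization lemma for uniform spaces: split the chain where half of
  its weight is used up.\<close>

lemma chain_short:
  "\<lbrakk>chain V ns x z; x \<in> topspace X; chain_weight ns < (1/2) ^ n\<rbrakk> \<Longrightarrow> z \<in> V n x"
proof (induction ns arbitrary: x z n rule: length_induct)
  case (1 ns)
  show ?case
  proof (cases "ns = []")
    case True
    with 1 show ?thesis by (simp add: refl)
  next
    case False
    have "chain_weight ns / 2 < chain_weight ns"
      using False chain_weight_nonneg[of "tl ns"] by (cases ns) (auto simp: add_nonneg_pos add.commute)
    then obtain as m bs where ns: "ns = as @ m # bs" "chain_weight as \<le> chain_weight ns / 2"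
      "chain_weight ns / 2 < chain_weight as + (1/2) ^ m"
      using chain_weight_split[of "chain_weight ns / 2" ns] chain_weight_nonneg[of ns] by auto
    obtain y u where y: "chain V as x y" and u: "u \<in> V m y" and z: "chain V bs u z"
      using 1(2) by (auto simp: ns(1) chain_append)
    have "y \<in> topspace X" "u \<in> topspace X"
      using chain_in_topspace[OF y 1(3)] u in_topspace by auto
    \<comment> \<open>Each outer part weighs at most half of the total, hence less than 2^-(n+1).
      The middle link alone weighs less than 2^-n, and strictness raises its level to at least n +
      1.\<close>
    have "(1/2 :: real) ^ m < (1/2) ^ n"
      using 1(4) chain_weight_nonneg[of as] chain_weight_nonneg[of bs] unfolding ns(1) chain_weight_simps by linarith
    then have "Suc n \<le> m"
      by simp
    then have "u \<in> V (Suc n) y"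
      using u \<open>y \<in> topspace X\<close> mono by blast
    moreover have "y \<in> V (Suc n) x"
      using 1(1)[rule_format, of as x y "Suc n"] y 1(3,4) ns by simp
    moreover have "z \<in> V (Suc n) u"
      using 1(1)[rule_format, of bs u z "Suc n"] z 1(4) ns \<open>u \<in> topspace X\<close> by simp
    ultimately show ?thesis using cube 1(3) by blast
  qed
qed

text \<open>\<open>f u\<close> is the least cost of reaching \<open>u\<close> from \<open>x\<close>,
  capped at 1. One more link of level \<open>n\<close> adds at most 2^-n, the empty chain gives
  \<open>f x \<le> 0\<close>, and a chain to \<open>z\<close> of weight below 1 = 2^-0 would put
  \<open>z\<close> into \<open>V 0 x\<close>.\<close>

lemma ex_chain_function:
  assumes x: "x \<in> topspace X" and z: "z \<in> topspace X" "z \<notin> V 0 x"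
  shows "\<exists>f :: 'a \<Rightarrow> real. (\<forall>n. \<forall>y\<in>topspace X. \<forall>u\<in>V n y. f u \<le> f y + (1/2) ^ n) \<and> f x + 1 \<le> f z"
proof -
  \<comment> \<open>The value 1 is inserted so that the infimum is taken over a nonempty set even
    where no chain from \<open>x\<close> arrives.\<close>
  define S where "S u = insert 1 {chain_weight ns | ns. chain V ns x u}" for u
  define f where "f u = Inf (S u)" for u
  have lb: "0 \<le> s" if "s \<in> S u" for s u
    using that chain_weight_nonneg by (auto simp: S_def)
  have bdd: "bdd_below (S u)" and ne: "S u \<noteq> {}" for u
    using lb by (auto simp: bdd_below_def S_def)
  have "f u \<le> f y + (1/2) ^ n" if "u \<in> V n y" for n y u
  proof -
    have "f u - (1/2) ^ n \<le> s" if s: "s \<in> S y" for s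
    proof (cases "s = 1")
      case True
      have "f u \<le> 1"
        unfolding f_def by (rule cInf_lower) (auto simp: bdd, simp add: S_def)
      then show ?thesis by (smt (verit) True zero_le_power zero_le_divide_1_iff zero_le_numeral)
    next
      case False
      with s obtain ns where ns: "s = chain_weight ns" "chain V ns x y" by (auto simp: S_def)
      then have "chain V (ns @ [n]) x u" using \<open>u \<in> V n y\<close> by (auto simp: chain_append)
      then have "chain_weight (ns @ [n]) \<in> S u" unfolding S_def by blast
      then have "f u \<le> chain_weight (ns @ [n])"
        unfolding f_def by (rule cInf_lower) (rule bdd)
      then show ?thesis using ns by simp
    qed
    then have "f u - (1/2) ^ n \<le> f y"
      unfolding f_def[of y] using cInf_greatest[OF ne] by blast
    then show ?thesis by simp
  qed
  moreover have "f x \<le> 0"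
  proof -
    have "0 \<in> S x"
      by (auto simp: S_def intro!: exI[of _ "[]"])
    then show ?thesis
      unfolding f_def by (rule cInf_lower) (rule bdd)
  qed
  moreover have "1 \<le> f z"
    unfolding f_def
  proof (rule cInf_greatest[OF ne])
    fix s assume "s \<in> S z"
    then show "1 \<le> s"
      using chain_short[OF _ x, of _ z 0] z by (force simp: S_def)
  qed
  ultimately show ?thesis by (intro exI[of _ f]) auto
qed

end

lemma ex_normal_sequence:
  assumes N: "all_normal X" and V: "nbhd_assignment X V"
  obtains W where "normal_sequence X W" "W 0 = V"
proof -
  \<comment> \<open>Dependent choice; the clause for \<open>n = 0\<close> pins the first member to
    \<open>V\<close>.\<close>
  have "\<exists>W. \<forall>n. (nbhd_assignment X (W n) \<and> (n = 0 \<longrightarrow> W n = V)) \<and>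
      (\<forall>x y z u. x \<in> topspace X \<and> y \<in> W (Suc n) x \<and> z \<in> W (Suc n) y \<and> u \<in> W (Suc n) z \<longrightarrow> u \<in> W n x)"
  proof (rule dependent_nat_choice)
    fix W and n :: nat assume "nbhd_assignment X W \<and> (n = 0 \<longrightarrow> W = V)"
    then obtain W' where "nbhd_assignment X W'"
      "\<And>x y z u. \<lbrakk>x \<in> topspace X; y \<in> W' x; z \<in> W' y; u \<in> W' z\<rbrakk> \<Longrightarrow> u \<in> W x"
      using nbhd_assignment_cube[OF N] by metis
    then show "\<exists>W'. (nbhd_assignment X W' \<and> (Suc n = 0 \<longrightarrow> W' = V)) \<and>
        (\<forall>x y z u. x \<in> topspace X \<and> y \<in> W' x \<and> z \<in> W' y \<and> u \<in> W' z \<longrightarrow> u \<in> W x)"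
      by (intro exI[of _ W']) auto
  qed (use V in auto)
  then obtain W where W: "\<forall>n. (nbhd_assignment X (W n) \<and> (n = 0 \<longrightarrow> W n = V)) \<and>
      (\<forall>x y z u. x \<in> topspace X \<and> y \<in> W (Suc n) x \<and> z \<in> W (Suc n) y \<and> u \<in> W (Suc n) z \<longrightarrow> u \<in> W n x)" ..
  have "normal_sequence X W"
    by unfold_locales (use W in blast)+
  moreover have "W 0 = V" using W by blast
  ultimately show thesis using that by blast
qed

text \<open>The family consists of all functions that rise by at most 2^-n along steps of level n.
  Then \<open>W n x\<close> is a common neighbourhood for all of them, and the chain functions from
  all base points belong to it.\<close>

lemma all_normal_equi_usc:
  assumes "all_normal X" "nbhd_assignment X V"
  obtains F where "equi_usc X F"
    "\<And>x y. \<lbrakk>x \<in> topspace X; y \<in> topspace X; \<forall>f\<in>F. f y < f x + 1\<rbrakk> \<Longrightarrow> y \<in> V x"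
proof -
  obtain W where W: "normal_sequence X W" "W 0 = V"
    using ex_normal_sequence assms by metis
  interpret normal_sequence X W by fact
  define F where "F = {f :: 'a \<Rightarrow> real. \<forall>n. \<forall>x\<in>topspace X. \<forall>y\<in>W n x. f y \<le> f x + (1/2) ^ n}"
  have "equi_usc X F"
    unfolding equi_usc_def
  proof (intro ballI allI impI)
    fix x and \<epsilon> :: real assume x: "x \<in> topspace X" "0 < \<epsilon>"
    obtain n where "(1/2) ^ n < \<epsilon>" using real_arch_pow_inv[OF x(2), of "1/2"] by auto
    then show "\<exists>A. openin X A \<and> x \<in> A \<and> (\<forall>f\<in>F. \<forall>y\<in>A. f y < f x + \<epsilon>)"
      using nbhd[of n] x
      by (intro exI[of _ "W n x"]) (fastforce simp: nbhd_assignment_def F_def)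
  qed
  moreover have "y \<in> V x" if "x \<in> topspace X" "y \<in> topspace X" "\<forall>f\<in>F. f y < f x + 1" for x y
  proof (rule ccontr)
    note xy = that
    assume "y \<notin> V x"
    then obtain f where "f \<in> F" "f x + 1 \<le> f y"
      using ex_chain_function[of x y] xy(1,2) unfolding F_def W(2) by blast
    with xy(3) show False by force
  qed
  ultimately show thesis using that by blast
qed

section \<open>One-sided uniform topologies\<close>

text \<open>Used with index type \<open>'a \<Rightarrow> real\<close>: a generator \<open>x\<close>
  goes to evaluation at \<open>x\<close>, so that one homomorphism extends every real function on
  the space at once.\<close>

definition pointwise_group :: "('b \<Rightarrow> real) monoid" where
  "pointwise_group = \<lparr>carrier = UNIV, monoid.mult = (\<lambda>u v i. u i + v i), one = (\<lambda>_. 0)\<rparr>"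

lemma pointwise_group_simps [simp]:
  "carrier pointwise_group = UNIV" "u \<otimes>\<^bsub>pointwise_group\<^esub> v = (\<lambda>i. u i + v i)"
  "\<one>\<^bsub>pointwise_group\<^esub> = (\<lambda>_. 0)"
  by (auto simp: pointwise_group_def)

lemma comm_group_pointwise: "comm_group pointwise_group"
proof (rule comm_groupI)
  fix u :: "'b \<Rightarrow> real"
  show "\<exists>v\<in>carrier pointwise_group. v \<otimes>\<^bsub>pointwise_group\<^esub> u = \<one>\<^bsub>pointwise_group\<^esub>"
    by (auto intro!: exI[of _ "\<lambda>i. - u i"])
qed (auto simp: algebra_simps)

lemma group_pointwise: "group pointwise_group"
  using comm_group_pointwise by (rule comm_group.axioms(2))

text \<open>The topology of the one-sided sup-distance over the coordinates in \<open>F\<close>: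
  these may drop freely and rise a little, all others are unrestricted.\<close>

definition one_sided :: "'b set \<Rightarrow> ('b \<Rightarrow> real) topology" where
  "one_sided F = topology (\<lambda>U. \<forall>u\<in>U. \<exists>\<epsilon>>0. \<forall>v. (\<forall>i\<in>F. v i < u i + \<epsilon>) \<longrightarrow> v \<in> U)"

lemma openin_one_sided:
  fixes F :: "'b set"
  shows "openin (one_sided F) U \<longleftrightarrow> (\<forall>u\<in>U. \<exists>\<epsilon>>0. \<forall>v. (\<forall>i\<in>F. v i < u i + \<epsilon>) \<longrightarrow> v \<in> U)"
proof -
  have "istopology (\<lambda>U :: ('b \<Rightarrow> real) set. \<forall>u\<in>U. \<exists>\<epsilon>>0. \<forall>v. (\<forall>i\<in>F. v i < u i + \<epsilon>) \<longrightarrow> v \<in> U)"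
    unfolding istopology_def
  proof (intro conjI allI impI ballI)
    fix S T :: "('b \<Rightarrow> real) set" and u :: "'b \<Rightarrow> real"
    assume S: "\<forall>u\<in>S. \<exists>\<epsilon>>0. \<forall>v. (\<forall>i\<in>F. v i < u i + \<epsilon>) \<longrightarrow> v \<in> S"
      and T: "\<forall>u\<in>T. \<exists>\<epsilon>>0. \<forall>v. (\<forall>i\<in>F. v i < u i + \<epsilon>) \<longrightarrow> v \<in> T" and u: "u \<in> S \<inter> T"
    from bspec[OF S IntD1[OF u]] bspec[OF T IntD2[OF u]]
    obtain \<epsilon> \<delta> where "\<epsilon> > 0" "\<forall>v. (\<forall>i\<in>F. v i < u i + \<epsilon>) \<longrightarrow> v \<in> S"
      "\<delta> > 0" "\<forall>v. (\<forall>i\<in>F. v i < u i + \<delta>) \<longrightarrow> v \<in> T"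
      by blast
    moreover have "(\<forall>i\<in>F. v i < u i + \<epsilon>) \<and> (\<forall>i\<in>F. v i < u i + \<delta>)"
      if "\<forall>i\<in>F. v i < u i + min \<epsilon> \<delta>" for v
      using that by fastforce
    ultimately show "\<exists>\<epsilon>>0. \<forall>v. (\<forall>i\<in>F. v i < u i + \<epsilon>) \<longrightarrow> v \<in> S \<inter> T"
      by (intro exI[of _ "min \<epsilon> \<delta>"]) simp
  next
    fix \<K> :: "('b \<Rightarrow> real) set set" and u :: "'b \<Rightarrow> real"
    assume \<K>: "\<forall>S\<in>\<K>. \<forall>u\<in>S. \<exists>\<epsilon>>0. \<forall>v. (\<forall>i\<in>F. v i < u i + \<epsilon>) \<longrightarrow> v \<in> S" and "u \<in> \<Union>\<K>"
    then obtain S where S: "S \<in> \<K>" "u \<in> S" by blast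
    from bspec[OF bspec[OF \<K> S(1)] S(2)] S(1)
    show "\<exists>\<epsilon>>0. \<forall>v. (\<forall>i\<in>F. v i < u i + \<epsilon>) \<longrightarrow> v \<in> \<Union>\<K>"
      by blast
  qed
  then show ?thesis by (simp add: one_sided_def)
qed

lemma topspace_one_sided [simp]: "topspace (one_sided F) = UNIV"
proof -
  have "openin (one_sided F) UNIV" by (auto simp: openin_one_sided intro: exI[of _ 1])
  then show ?thesis using openin_subset by blast
qed

text \<open>For infinite \<open>F\<close>, strict inequalities with \<epsilon> leave no uniform
  slack. The ball therefore asks for a common bound r < \<epsilon>, and half of \<epsilon> - r is a
  radius around each of its points.\<close>

lemma openin_one_sided_ball:
  "openin (one_sided F) {v. \<exists>r<\<epsilon>. \<forall>i\<in>F. v i \<le> u i + r}"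
  unfolding openin_one_sided
proof
  fix v assume "v \<in> {v. \<exists>r<\<epsilon>. \<forall>i\<in>F. v i \<le> u i + r}"
  then obtain r where r: "r < \<epsilon>" "\<forall>i\<in>F. v i \<le> u i + r" by auto
  have "\<forall>i\<in>F. v' i \<le> u i + (r + \<epsilon>) / 2" if "\<forall>i\<in>F. v' i < v i + (\<epsilon> - r) / 2" for v'
  proof
    fix i assume "i \<in> F"
    then have "v' i < v i + (\<epsilon> - r) / 2" "v i \<le> u i + r" using that r by auto
    then show "v' i \<le> u i + (r + \<epsilon>) / 2" by argo
  qed
  moreover have "(r + \<epsilon>) / 2 < \<epsilon>" using r by simp
  ultimately show "\<exists>\<delta>>0. \<forall>v'. (\<forall>i\<in>F. v' i < v i + \<delta>) \<longrightarrow> v' \<in> {v. \<exists>r<\<epsilon>. \<forall>i\<in>F. v i \<le> u i + r}"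
    using r(1) by (intro exI[of _ "(\<epsilon> - r) / 2"]) fastforce
qed

lemma paratopological_group_one_sided:
  fixes F :: "'b set"
  shows "paratopological_group pointwise_group (one_sided F)"
proof -
  have "openin (prod_topology (one_sided F) (one_sided F))
      {p. (\<lambda>(u, v). u \<otimes>\<^bsub>pointwise_group\<^esub> v) p \<in> U}" if U: "openin (one_sided F) U" for U
    unfolding openin_prod_topology_alt
  proof (intro allI impI)
    fix u v :: "'b \<Rightarrow> real"
    assume "(u, v) \<in> {p. (\<lambda>(u, v). u \<otimes>\<^bsub>pointwise_group\<^esub> v) p \<in> U}"
    then have "(\<lambda>i. u i + v i) \<in> U" by simp
    from bspec[OF U[unfolded openin_one_sided] this]
    obtain \<epsilon> where \<epsilon>: "\<epsilon> > 0" "\<And>w. \<forall>i\<in>F. w i < u i + v i + \<epsilon> \<Longrightarrow> w \<in> U"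
      by blast
    let ?B = "\<lambda>u. {v. \<exists>r<\<epsilon> / 2. \<forall>i\<in>F. v i \<le> u i + r}"
    have "(\<lambda>i. u' i + v' i) \<in> U" if "u' \<in> ?B u" "v' \<in> ?B v" for u' v'
    proof -
      note uv = that
      obtain r s where "r < \<epsilon> / 2" "\<forall>i\<in>F. u' i \<le> u i + r" "s < \<epsilon> / 2" "\<forall>i\<in>F. v' i \<le> v i + s"
        using uv unfolding mem_Collect_eq by blast
      then show ?thesis by (intro \<epsilon>(2)) fastforce
    qed
    then show "\<exists>A B. openin (one_sided F) A \<and> openin (one_sided F) B \<and> u \<in> A \<and> v \<in> B \<and>
        A \<times> B \<subseteq> {p. (\<lambda>(u, v). u \<otimes>\<^bsub>pointwise_group\<^esub> v) p \<in> U}"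
      using \<epsilon>(1) by (intro exI[of _ "?B u"] exI[of _ "?B v"] conjI openin_one_sided_ball) (auto intro: exI[of _ 0])
  qed
  then show ?thesis
    by (simp add: paratopological_group_def group_pointwise continuous_map_def)
qed

lemma continuous_map_eval_one_sided:
  assumes "equi_usc X F" shows "continuous_map X (one_sided F) (\<lambda>x f. f x)"
  unfolding continuous_map_def
proof (intro conjI allI impI)
  fix U assume U: "openin (one_sided F) U"
  show "openin X {x \<in> topspace X. (\<lambda>f. f x) \<in> U}"
  proof (subst openin_subopen, rule ballI)
    fix x assume "x \<in> {x \<in> topspace X. (\<lambda>f. f x) \<in> U}"
    then have x: "x \<in> topspace X" "(\<lambda>f. f x) \<in> U" by auto
    from bspec[OF U[unfolded openin_one_sided] x(2)]
    obtain \<epsilon> where \<epsilon>: "\<epsilon> > 0" "\<forall>w. (\<forall>f\<in>F. w f < f x + \<epsilon>) \<longrightarrow> w \<in> U"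
      by blast
    from assms[unfolded equi_usc_def, rule_format, OF x(1) \<epsilon>(1)]
    obtain A where A: "openin X A" "x \<in> A" "\<forall>f\<in>F. \<forall>y\<in>A. f y < f x + \<epsilon>"
      by blast
    have "(\<lambda>f. f y) \<in> U" if "y \<in> A" for y
      using \<epsilon>(2)[rule_format, of "\<lambda>f. f y"] A(3) that by simp
    then show "\<exists>A. openin X A \<and> x \<in> A \<and> A \<subseteq> {x \<in> topspace X. (\<lambda>f. f x) \<in> U}"
      using A openin_subset[OF A(1)] by blast
  qed
qed auto


section \<open>Words of two letters\<close>

text \<open>The common setting of both free groups. No topology is fixed on the target of
  \<open>h\<close>, because the set of coordinates that matter changes from one application to the
  next.\<close>

locale free_paratopological =
  fixes K :: "'g monoid \<Rightarrow> bool" and X :: "'a topology" and \<iota> :: "'a \<Rightarrow> 'g"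
    and G :: "'g monoid" (structure) and T :: "'g topology" and h :: "'g \<Rightarrow> ('a \<Rightarrow> real) \<Rightarrow> real"
  assumes free: "free_paratopological_group K X \<iota> G T"
    and h_hom: "h \<in> hom G pointwise_group"
    and h_gen: "x \<in> topspace X \<Longrightarrow> h (\<iota> x) = (\<lambda>f. f x)"
begin

sublocale group G
  using free by (simp add: free_paratopological_group_def paratopological_group_def)

lemma topspace_T: "topspace T = carrier G"
  using free by (simp add: free_paratopological_group_def paratopological_group_def)

lemma gen_closed [simp]: "x \<in> topspace X \<Longrightarrow> \<iota> x \<in> carrier G"
  using free generate.incl[of "\<iota> x" "\<iota> ` topspace X" G] by (auto simp: free_paratopological_group_def)

lemma h_mult: "\<lbrakk>a \<in> carrier G; b \<in> carrier G\<rbrakk> \<Longrightarrow> h (a \<otimes> b) f = h a f + h b f"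
  using h_hom by (simp add: hom_def)

lemma h_one [simp]: "h \<one> f = 0"
  using h_mult[of \<one> \<one>] by simp

lemma h_inv: "a \<in> carrier G \<Longrightarrow> h (inv a) f = - h a f"
  using h_mult[of "inv a" a f] by simp

text \<open>By the extension property, \<open>h\<close> is continuous into
  \<open>one_sided F\<close>. Radius 1 is enough for integer-valued tests, where the bound on words
  means that the value does not increase.\<close>

lemma h_neighbourhood:
  assumes "equi_usc X F" "w \<in> carrier G"
  shows "\<exists>W. openin T W \<and> w \<in> W \<and> (\<forall>w'\<in>W. \<forall>f\<in>F. h w' f < h w f + 1)"
proof -
  let ?B = "{v. \<exists>r<1. \<forall>f\<in>F. v f \<le> h w f + r}"
  have "continuous_map T (one_sided F) h"
    using free paratopological_group_one_sided continuous_map_eval_one_sided[OF assms(1)] h_hom h_gen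
    by (rule free_paratopological_group_continuous)
  then have "openin T {w' \<in> topspace T. h w' \<in> ?B}"
    using openin_one_sided_ball by (rule openin_continuous_map_preimage)
  then show ?thesis
    using assms(2) by (intro exI[of _ "{w' \<in> topspace T. h w' \<in> ?B}"]) (fastforce simp: topspace_T intro: exI[of _ 0])
qed

abbreviation "\<L> \<equiv> letter_space G T (\<iota> ` topspace X)"

text \<open>The tags are the indices of the summands in \<open>letter_space\<close>. Signed points
  have the form of the letters of the free group, and are used for both groups.\<close>

definition letter :: "'a \<times> bool \<Rightarrow> nat \<times> 'g" where
  "letter l = (if snd l then (0, \<iota> (fst l)) else (1, inv \<iota> (fst l)))"

abbreviation letter_e :: "nat \<times> 'g" where
  "letter_e \<equiv> (2, \<one>)"

lemma letter_inject:
  assumes "x \<in> topspace X" "y \<in> topspace X"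
  shows "letter (x, b) = letter (y, c) \<longleftrightarrow> x = y \<and> b = c"
proof -
  have "x = y" if "\<iota> x = \<iota> y"
  proof -
    \<comment> \<open>Generators are told apart by \<open>h\<close> at the indicator of a
      point.\<close>
    have "indicator {x} x = (indicator {x} y :: real)"
      using that h_gen[OF assms(1)] h_gen[OF assms(2)] fun_cong by metis
    then show ?thesis by (simp split: split_indicator_asm)
  qed
  moreover have "\<iota> x = \<iota> y" if "inv \<iota> x = inv \<iota> y"
    using that assms inv_inv gen_closed by metis
  ultimately show ?thesis
    using assms by (auto simp: letter_def)
qed

lemma letter_neq [simp]: "letter l \<noteq> letter_e" "letter_e \<noteq> letter l"
  by (auto simp: letter_def)

lemma topspace_letters: "topspace \<L> = insert letter_e (letter ` (topspace X \<times> UNIV))"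
proof -
  have "topspace \<L> = {0} \<times> (\<iota> ` topspace X) \<union> {1} \<times> (m_inv G ` \<iota> ` topspace X) \<union> {letter_e}"
    by (auto simp: letter_space_def topspace_T)
  also have "\<dots> = insert letter_e (letter ` (topspace X \<times> UNIV))"
  proof -
    have "topspace X \<times> (UNIV :: bool set) = (\<lambda>x. (x, True)) ` topspace X \<union> (\<lambda>x. (x, False)) ` topspace X"
      by (auto simp: UNIV_bool)
    then show ?thesis
      unfolding letter_def by (simp only: image_Un image_image fst_conv snd_conv if_True if_False) blast
  qed
  finally show ?thesis .
qed

lemma letter_in_letters [simp]: "x \<in> topspace X \<Longrightarrow> letter (x, b) \<in> topspace \<L>"
  by (simp add: topspace_letters)

lemma letter_cases [consumes 1]:
  assumes "p \<in> topspace \<L>"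
  obtains (letter) x b where "x \<in> topspace X" "p = letter (x, b)" | (one) "p = letter_e"
proof (cases "p = letter_e")
  case False
  then obtain l where "l \<in> topspace X \<times> UNIV" "p = letter l"
    using assms unfolding topspace_letters by blast
  then show thesis using letter[of "fst l" "snd l"] by (simp add: mem_Times_iff)
qed (rule one)

lemma snd_letter_closed [simp]: "p \<in> topspace \<L> \<Longrightarrow> snd p \<in> carrier G"
  by (erule letter_cases) (simp_all add: letter_def)

lemma h_letter: "x \<in> topspace X \<Longrightarrow> h (snd (letter (x, b))) f = (if b then f x else - f x)"
  by (simp add: letter_def h_inv h_gen)

lemma openin_gen: "openin (subtopology T (\<iota> ` topspace X)) V \<longleftrightarrow>
    V \<subseteq> \<iota> ` topspace X \<and> openin X {x \<in> topspace X. \<iota> x \<in> V}"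
proof -
  have hm: "homeomorphic_map X (subtopology T (\<iota> ` topspace X)) \<iota>"
    using free by (simp add: free_paratopological_group_def embedding_map_def)
  have "\<iota> ` {x \<in> topspace X. \<iota> x \<in> V} = V" if "V \<subseteq> \<iota> ` topspace X"
    using that by auto
  then show ?thesis
    using homeomorphic_map_openness[OF hm, of "{x \<in> topspace X. \<iota> x \<in> V}"] openin_subset[of "subtopology T (\<iota> ` topspace X)" V]
    by auto
qed

text \<open>The other two summands are discrete, so openness is a condition on the positive letters
  alone.\<close>

lemma openin_letters:
  "openin \<L> U \<longleftrightarrow> U \<subseteq> topspace \<L> \<and> openin X {x \<in> topspace X. letter (x, True) \<in> U}"
proof -
  have *: "U \<subseteq> topspace \<L> \<Longrightarrow>
      {x. (0, x) \<in> U} \<subseteq> \<iota> ` topspace X \<and> {x. (1, x) \<in> U} \<subseteq> m_inv G ` \<iota> ` topspace X \<and> {x. (2, x) \<in> U} \<subseteq> {\<one>}"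
    by (auto simp: topspace_letters letter_def split: if_splits)
  have "U \<subseteq> Sigma {0,1,2} (topspace \<circ> (!) [subtopology T (\<iota> ` topspace X),
          discrete_topology (m_inv G ` \<iota> ` topspace X), discrete_topology {\<one>}]) \<longleftrightarrow> U \<subseteq> topspace \<L>"
    by (simp only: letter_space_def topspace_sum_topology)
  then show ?thesis
    unfolding letter_space_def openin_sum_topology
    using * by (auto simp: openin_gen letter_def[of "(_, True)"])
qed

text \<open>A basic neighbourhood of a letter: a positive letter may move in \<open>A\<close>, an
  inverse letter is isolated.\<close>

definition letter_nbhd :: "'a set \<Rightarrow> 'a \<times> bool \<Rightarrow> (nat \<times> 'g) set" where
  "letter_nbhd A l = (if snd l then (\<lambda>z. letter (z, True)) ` A else {letter l})"

lemma openin_letter_nbhd: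
  assumes "openin X A" "x \<in> topspace X" shows "openin \<L> (letter_nbhd A (x, b))"
proof -
  have A: "A \<subseteq> topspace X" using openin_subset assms by auto
  then have "{z \<in> topspace X. letter (z, True) \<in> letter_nbhd A (x, b)} = (if b then A else {})"
    using assms by (auto simp: letter_nbhd_def letter_inject subset_iff)
  then show ?thesis
    unfolding openin_letters using assms A by (auto simp: letter_nbhd_def topspace_letters)
qed

lemma openin_letter_e: "openin \<L> {letter_e}"
  by (auto simp: openin_letters topspace_letters)

lemma ex_letter_nbhd:
  assumes "openin \<L> U" "letter (x, b) \<in> U" "x \<in> topspace X"
  obtains A where "openin X A" "x \<in> A" "letter_nbhd A (x, b) \<subseteq> U"
proof (cases b)
  case True
  with assms that[of "{z \<in> topspace X. letter (z, True) \<in> U}"] show thesis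
    by (auto simp: openin_letters letter_nbhd_def)
next
  case False
  with assms that[of "topspace X"] show thesis
    by (auto simp: letter_nbhd_def)
qed

lemma continuous_letters: "continuous_map \<L> T snd"
  unfolding continuous_map_def
proof (intro conjI allI impI)
  fix U assume U: "openin T U"
  have "openin (subtopology T (\<iota> ` topspace X)) (U \<inter> \<iota> ` topspace X)"
    using U by (auto simp: openin_subtopology)
  then have "openin X {x \<in> topspace X. \<iota> x \<in> U \<inter> \<iota> ` topspace X}"
    unfolding openin_gen by simp
  also have "{x \<in> topspace X. \<iota> x \<in> U \<inter> \<iota> ` topspace X} =
      {x \<in> topspace X. letter (x, True) \<in> {p \<in> topspace \<L>. snd p \<in> U}}"
  proof -
    have "letter (x, True) \<in> topspace \<L>" "snd (letter (x, True)) = \<iota> x" if "x \<in> topspace X" for x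
      using that by (simp, simp add: letter_def)
    then show ?thesis by force
  qed
  finally show "openin \<L> {p \<in> topspace \<L>. snd p \<in> U}"
    unfolding openin_letters by auto
qed (simp add: topspace_T)

lemma continuous_i2: "continuous_map (prod_topology \<L> \<L>) T (i2 G)"
proof -
  have "continuous_map (prod_topology \<L> \<L>) (prod_topology T T) (\<lambda>p. (snd (fst p), snd (snd p)))"
    by (intro continuous_map_pairedI
        continuous_map_compose[OF continuous_map_fst continuous_letters, unfolded o_def]
        continuous_map_compose[OF continuous_map_snd continuous_letters, unfolded o_def])
  moreover have "continuous_map (prod_topology T T) T (\<lambda>(x, y). x \<otimes> y)"
    using free by (simp add: free_paratopological_group_def paratopological_group_def)
  ultimately have "continuous_map (prod_topology \<L> \<L>) T ((\<lambda>(x, y). x \<otimes> y) \<circ> (\<lambda>p. (snd (fst p), snd (snd p))))"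
    by (rule continuous_map_compose)
  then show ?thesis
    by (simp add: o_def i2_def case_prod_unfold)
qed


section \<open>Neighbourhoods of two-letter words from real-valued tests\<close>

lemma i2_apply: "i2 G (p, q) = snd p \<otimes> snd q"
  by (simp add: i2_def case_prod_unfold)

text \<open>The constants 1 and -1 bound the exponent sum from above and below; being an integer on
  words, it is thereby fixed. For a closed set \<open>C\<close>, the bound says that the signed
  number of letters in \<open>C\<close> does not exceed that of \<open>w\<close>.\<close>

lemma closed_neighbourhood:
  assumes w: "w \<in> carrier G" and F: "equi_usc X F" and C: "\<forall>C\<in>set Cs. closedin X C"
  obtains W where "openin T W" "w \<in> W"
    "\<And>w'. w' \<in> W \<Longrightarrow> \<forall>f\<in>F. h w' f < h w f + 1"
    "\<And>w'. w' \<in> W \<Longrightarrow> \<forall>C\<in>set Cs. h w' (indicator C) < h w (indicator C) + 1"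
    "\<And>w'. w' \<in> W \<Longrightarrow> h w' (\<lambda>_. 1) < h w (\<lambda>_. 1) + 1"
    "\<And>w'. w' \<in> W \<Longrightarrow> h w' (\<lambda>_. -1) < h w (\<lambda>_. -1) + 1"
proof -
  have "equi_usc X (indicator ` set Cs)"
    using C by (induction Cs) (simp_all add: equi_usc_empty equi_usc_insert equi_usc_closed)
  then have "equi_usc X (insert (\<lambda>_. 1) (insert (\<lambda>_. -1) (F \<union> indicator ` set Cs)))"
    by (intro equi_usc_insert[OF equi_usc_const] equi_usc_Un[OF F])
  from h_neighbourhood[OF this w] obtain W where W: "openin T W" "w \<in> W"
    "\<forall>w'\<in>W. \<forall>f\<in>insert (\<lambda>_. 1) (insert (\<lambda>_. -1) (F \<union> indicator ` set Cs)). h w' f < h w f + 1"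
    by blast
  then show thesis by (intro that[of W]) auto
qed

text \<open>The exponent sum leaves the right signs up to order, and for opposite signs also the
  pair of neutral letters, which a singleton test excludes. The closed sets then locate the
  points.\<close>

lemma neighbourhood_pair:
  assumes "t1_space X" "w \<in> carrier G" "x \<in> topspace X" "y \<in> topspace X"
    and A: "openin X A" "x \<in> A" and B: "openin X B" "y \<in> B"
    and red: "(y, c) \<noteq> flip (x, b)"
    and w: "\<And>f. h w f = (if b then f x else - f x) + (if c then f y else - f y)"
  obtains W where "openin T W" "w \<in> W"
    "\<And>p q. \<lbrakk>p \<in> topspace \<L>; q \<in> topspace \<L>; snd p \<otimes> snd q \<in> W\<rbrakk> \<Longrightarrow>
       (p, q) \<in> letter_nbhd A (x, b) \<times> letter_nbhd B (y, c) \<union> letter_nbhd B (y, c) \<times> letter_nbhd A (x, b)"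
proof -
  have sing: "closedin X {x}" "closedin X {y}"
    using assms(1,3,4) by (auto simp: t1_space_closedin_singleton)
  \<comment> \<open>Two positive letters: at most one point misses \<open>A\<close>, at most one
    misses \<open>B\<close>, none misses both. Opposite signs: the singleton, counted -1, pins the
    inverse letter, and the second set, also counted -1, forces the positive letter into its
    neighbourhood. Two inverse letters: each singleton is hit at least as often as in
    \<open>w\<close>.\<close>
  define Cs where "Cs = (if b then if c then [topspace X - A, topspace X - B, topspace X - (A \<union> B)]
      else [{y}, topspace X - (A - {y})] else if c then [{x}, topspace X - (B - {x})] else [{x}, {y}])"
  have "\<forall>C\<in>set Cs. closedin X C"
    using A(1) B(1) sing by (auto simp: Cs_def intro!: openin_diff)
  from closed_neighbourhood[OF assms(2) equi_usc_empty this]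
  obtain W where W: "openin T W" "w \<in> W"
    "\<And>w'. w' \<in> W \<Longrightarrow> \<forall>C\<in>set Cs. h w' (indicator C) < h w (indicator C) + 1"
    "\<And>w'. w' \<in> W \<Longrightarrow> h w' (\<lambda>_. 1) < h w (\<lambda>_. 1) + 1"
    "\<And>w'. w' \<in> W \<Longrightarrow> h w' (\<lambda>_. -1) < h w (\<lambda>_. -1) + 1"
    by metis
  have "(p, q) \<in> letter_nbhd A (x, b) \<times> letter_nbhd B (y, c) \<union> letter_nbhd B (y, c) \<times> letter_nbhd A (x, b)"
    if pq: "p \<in> topspace \<L>" "q \<in> topspace \<L>" "snd p \<otimes> snd q \<in> W" for p q
  proof -
    have hpq: "h (snd p \<otimes> snd q) f = h (snd p) f + h (snd q) f" for f
      using pq by (simp add: h_mult)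
    note d = W(4)[OF pq(3), unfolded hpq w] W(5)[OF pq(3), unfolded hpq w]
    note C = W(3)[OF pq(3), unfolded hpq w Cs_def]
    have xy: "x \<noteq> y" if "b \<noteq> c" using red that by (auto simp: flip_def)
    have x: "x \<in> topspace X" "y \<in> topspace X" by fact+
    have one: False if "p = letter_e" "q = letter_e"
      using d C that xy by (cases b; cases c) (auto simp: indicator_def)
    obtain z s where z: "z \<in> topspace X" "p = letter (z, s)"
      using pq(1)
    proof (cases rule: letter_cases)
      case p: one
      from pq(2) have False
        by (cases rule: letter_cases) (use p d one in \<open>auto simp: h_letter split: if_splits\<close>)
      then show thesis ..
    qed
    obtain t u where t: "t \<in> topspace X" "q = letter (t, u)"
      using pq(2)
    proof (cases rule: letter_cases)
      case one
      then have False
        using d z by (auto simp: h_letter split: if_splits)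
      then show thesis ..
    qed
    have lzt: "h (snd p) f = (if s then f z else - f z)" "h (snd q) f = (if u then f t else - f t)" for f
      using z t by (simp_all add: h_letter)
    note C = C[unfolded lzt] and d = d[unfolded lzt]
    show ?thesis
    proof (cases b; cases c)
      assume bc: b c
      have su: s u using d bc by (auto split: if_splits)
      have "z \<in> A \<or> t \<in> A" "z \<in> B \<or> t \<in> B" "z \<in> A \<or> z \<in> B" "t \<in> A \<or> t \<in> B"
        using C bc su z(1) t(1) x A(2) B(2) by (auto simp: indicator_def)
      then show ?thesis using bc su z t by (auto simp: letter_nbhd_def)
    next
      assume bc: b "\<not> c"
      have su: "s \<longleftrightarrow> \<not> u" using d bc by (auto split: if_splits)
      have "s \<longrightarrow> t = y \<and> z \<in> A" "\<not> s \<longrightarrow> z = y \<and> t \<in> A"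
        using C bc su z(1) t(1) x A(2) B(2) xy by (auto simp: indicator_def of_bool_def split: if_splits)
      then show ?thesis using bc su z t by (cases s) (auto simp: letter_nbhd_def)
    next
      assume bc: "\<not> b" c
      have su: "s \<longleftrightarrow> \<not> u" using d bc by (auto split: if_splits)
      have "s \<longrightarrow> t = x \<and> z \<in> B" "\<not> s \<longrightarrow> z = x \<and> t \<in> B"
        using C bc su z(1) t(1) x A(2) B(2) xy by (auto simp: indicator_def of_bool_def split: if_splits)
      then show ?thesis using bc su z t by (cases s) (auto simp: letter_nbhd_def)
    next
      assume bc: "\<not> b" "\<not> c"
      have su: "\<not> s" "\<not> u" using d bc by (auto split: if_splits)
      have "z = x \<or> t = x" "z = y \<or> t = y" "z = x \<or> z = y" "t = x \<or> t = y"
        using C bc su by (auto simp: indicator_def of_bool_def split: if_splits)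
      then show ?thesis using bc su z t by (auto simp: letter_nbhd_def)
    qed
  qed
  with W show thesis using that by blast
qed

text \<open>Exponent sum 1 or -1 makes exactly one of the two letters neutral; the single closed set
  places the other one.\<close>

lemma neighbourhood_single:
  assumes "t1_space X" "w \<in> carrier G" "x \<in> topspace X" and A: "openin X A" "x \<in> A"
    and w: "\<And>f. h w f = (if b then f x else - f x)"
  obtains W where "openin T W" "w \<in> W"
    "\<And>p q. \<lbrakk>p \<in> topspace \<L>; q \<in> topspace \<L>; snd p \<otimes> snd q \<in> W\<rbrakk> \<Longrightarrow>
       (p, q) \<in> letter_nbhd A (x, b) \<times> {letter_e} \<union> {letter_e} \<times> letter_nbhd A (x, b)"
proof -
  define Cs where "Cs = (if b then [topspace X - A] else [{x}])"
  have "\<forall>C\<in>set Cs. closedin X C"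
    using A(1) assms(1,3) by (auto simp: Cs_def t1_space_closedin_singleton)
  from closed_neighbourhood[OF assms(2) equi_usc_empty this]
  obtain W where W: "openin T W" "w \<in> W"
    "\<And>w'. w' \<in> W \<Longrightarrow> \<forall>C\<in>set Cs. h w' (indicator C) < h w (indicator C) + 1"
    "\<And>w'. w' \<in> W \<Longrightarrow> h w' (\<lambda>_. 1) < h w (\<lambda>_. 1) + 1"
    "\<And>w'. w' \<in> W \<Longrightarrow> h w' (\<lambda>_. -1) < h w (\<lambda>_. -1) + 1"
    by metis
  have "(p, q) \<in> letter_nbhd A (x, b) \<times> {letter_e} \<union> {letter_e} \<times> letter_nbhd A (x, b)"
    if pq: "p \<in> topspace \<L>" "q \<in> topspace \<L>" "snd p \<otimes> snd q \<in> W" for p q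
  proof -
    have hpq: "h (snd p \<otimes> snd q) f = h (snd p) f + h (snd q) f" for f
      using pq by (simp add: h_mult)
    note d = W(4)[OF pq(3), unfolded hpq w] W(5)[OF pq(3), unfolded hpq w]
    note C = W(3)[OF pq(3), unfolded hpq w Cs_def]
    from pq(1) show ?thesis
    proof (cases rule: letter_cases)
      case p: (letter z s)
      from pq(2) have q: "q = letter_e"
        by (cases rule: letter_cases) (use d p in \<open>auto simp: h_letter split: if_splits\<close>)
      then show ?thesis using d C p A
        by (auto simp: h_letter letter_nbhd_def indicator_def split: if_splits)
    next
      case p: one
      from pq(2) show ?thesis
        by (cases rule: letter_cases)
          (use p d C A in \<open>auto simp: h_letter letter_nbhd_def indicator_def split: if_splits\<close>)
    qed
  qed
  with W show thesis using that by blast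
qed

text \<open>Exponent sum 0 leaves two neutral letters or two letters of opposite sign. In the second
  case \<open>h\<close> evaluates at \<open>f\<close> to the value at the positive point minus that
  at the inverse one, and the family \<open>F\<close> places the former in \<open>V\<close> of the
  latter.\<close>

lemma neighbourhood_one:
  assumes "all_normal X" "nbhd_assignment X V"
  obtains W where "openin T W" "\<one> \<in> W"
    "\<And>p q. \<lbrakk>p \<in> topspace \<L>; q \<in> topspace \<L>; snd p \<otimes> snd q \<in> W\<rbrakk> \<Longrightarrow>
       (p, q) = (letter_e, letter_e) \<or>
       (\<exists>x\<in>topspace X. \<exists>y\<in>V x. (p, q) = (letter (x, False), letter (y, True)) \<or> (p, q) = (letter (y, True), letter (x, False)))"
proof -
  obtain F where F: "equi_usc X F"
    "\<And>x y. \<lbrakk>x \<in> topspace X; y \<in> topspace X; \<forall>f\<in>F. f y < f x + 1\<rbrakk> \<Longrightarrow> y \<in> V x"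
    using all_normal_equi_usc[OF assms] by metis
  from closed_neighbourhood[OF one_closed F(1), of "[]"]
  obtain W where W: "openin T W" "\<one> \<in> W"
    "\<And>w'. w' \<in> W \<Longrightarrow> \<forall>f\<in>F. h w' f < h \<one> f + 1"
    "\<And>w'. w' \<in> W \<Longrightarrow> h w' (\<lambda>_. 1) < h \<one> (\<lambda>_. 1) + 1"
    "\<And>w'. w' \<in> W \<Longrightarrow> h w' (\<lambda>_. -1) < h \<one> (\<lambda>_. -1) + 1"
    by auto
  have "(p, q) = (letter_e, letter_e) \<or>
       (\<exists>x\<in>topspace X. \<exists>y\<in>V x. (p, q) = (letter (x, False), letter (y, True)) \<or> (p, q) = (letter (y, True), letter (x, False)))"
    if pq: "p \<in> topspace \<L>" "q \<in> topspace \<L>" "snd p \<otimes> snd q \<in> W" for p q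
  proof -
    have hpq: "h (snd p \<otimes> snd q) f = h (snd p) f + h (snd q) f" for f
      using pq by (simp add: h_mult)
    note d = W(4)[OF pq(3), unfolded hpq] W(5)[OF pq(3), unfolded hpq]
    note f = W(3)[OF pq(3), unfolded hpq]
    from pq(1) show ?thesis
    proof (cases rule: letter_cases)
      case p: (letter z s)
      from pq(2) show ?thesis
      proof (cases rule: letter_cases)
        case q: (letter t u)
        have "u \<longleftrightarrow> \<not> s" using d p q by (auto simp: h_letter split: if_splits)
        then show ?thesis
          using F(2)[of t z] F(2)[of z t] f p q by (cases s) (auto simp: h_letter algebra_simps)
      qed (use d p in \<open>auto simp: h_letter split: if_splits\<close>)
    next
      case p: one
      from pq(2) show ?thesis
        by (cases rule: letter_cases) (use p d in \<open>auto simp: h_letter split: if_splits\<close>)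
    qed
  qed
  with W show thesis using that by blast
qed

end

section \<open>From a quotient map to normal neighbournets\<close>

lemma diff_eq_imp:
  fixes z t z' t' :: 'a
  assumes "\<And>f :: 'a \<Rightarrow> real. f z - f t = f z' - f t'"
  shows "z = t \<or> z = z' \<and> t = t'"
  using assms[of "indicator {z}"] assms[of "indicator {t}"]
  by (auto simp: indicator_def of_bool_def split: if_splits)

context free_paratopological
begin

lemma continuous_gen: "continuous_map X T \<iota>"
  using free homeomorphic_imp_continuous_map
  by (fastforce simp: free_paratopological_group_def embedding_map_def continuous_map_in_subtopology)

lemma continuous_mult: "continuous_map (prod_topology T T) T (\<lambda>(a, b). a \<otimes> b)"
  using free by (simp add: free_paratopological_group_def paratopological_group_def)

lemma openin_translate:
  assumes "openin T P" "a \<in> carrier G" shows "openin X {y \<in> topspace X. a \<otimes> \<iota> y \<in> P}"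
proof -
  have "continuous_map X (prod_topology T T) (\<lambda>y. (a, \<iota> y))"
    using assms(2) by (intro continuous_map_pairedI continuous_gen) (simp add: topspace_T)
  from continuous_map_compose[OF this continuous_mult] assms(1)
  show ?thesis by (simp add: continuous_map_def o_def)
qed

lemma quotient_imp_all_normal:
  assumes q: "quotient_map (prod_topology \<L> \<L>) (subtopology T S) (i2 G)"
  shows "all_normal X"
  unfolding all_normal_def
proof (intro allI impI)
  fix V assume V: "nbhd_assignment X V"
  show "\<exists>W. nbhd_assignment X W \<and> (\<forall>x\<in>topspace X. \<forall>y\<in>W x. W y \<subseteq> V x)"
  proof (cases "topspace X = {}")
    case True
    then show ?thesis by (simp add: nbhd_assignment_def)
  next
    case False
    \<comment> \<open>the words \<open>t\<^sup>-\<^sup>1z\<close> and \<open>zt\<^sup>-\<^sup>1\<close> with \<open>z\<close> in \<^term>\<open>V t\<close>, recognised by their image in the free Abelian group\<close>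
    define U where "U = {w \<in> topspace (subtopology T S). \<exists>t\<in>topspace X. \<exists>z\<in>V t. \<forall>f. h w f = f z - f t}"
    \<comment> \<open>A nonzero difference of two generators determines both, so membership does not
      depend on how \<open>w\<close> is written; for the zero difference, \<open>z = t\<close> lies
      in \<open>V t\<close> anyway.\<close>
    have U: "z \<in> V t" if "w \<in> U" "t \<in> topspace X" "\<And>f. h w f = f z - f t" for w z t
    proof -
      from \<open>w \<in> U\<close> obtain t' z' where t': "t' \<in> topspace X" "z' \<in> V t'" "\<And>f. h w f = f z' - f t'"
        unfolding U_def by blast
      have "f z - f t = f z' - f t'" for f :: "'a \<Rightarrow> real" using that(3) t'(3) by metis
      from diff_eq_imp[of z t z' t', OF this] show ?thesis
        using t' nbhd_assignmentD(1)[OF V] that(2) by auto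
    qed
    have in_sub: "snd p \<otimes> snd q \<in> topspace (subtopology T S)" if "p \<in> topspace \<L>" "q \<in> topspace \<L>" for p q
    proof -
      have "i2 G (p, q) \<in> i2 G ` topspace (prod_topology \<L> \<L>)"
        using that by (intro imageI) simp
      then show ?thesis using q by (simp add: quotient_map_def i2_apply)
    qed
    have UI: "snd p \<otimes> snd q \<in> U"
      if "p \<in> topspace \<L>" "q \<in> topspace \<L>" "t \<in> topspace X" "z \<in> V t" "\<And>f. h (snd p) f + h (snd q) f = f z - f t" for p q z t
      using that in_sub unfolding U_def by (auto simp: h_mult)
    have "openin (prod_topology \<L> \<L>) {p \<in> topspace (prod_topology \<L> \<L>). i2 G p \<in> U}"
    proof (subst openin_prod_topology_alt, intro allI impI)
      fix p q assume "(p, q) \<in> {p \<in> topspace (prod_topology \<L> \<L>). i2 G p \<in> U}"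
      then have pq: "p \<in> topspace \<L>" "q \<in> topspace \<L>" "snd p \<otimes> snd q \<in> U" by (auto simp: i2_apply)
      then obtain t' z' where t': "t' \<in> topspace X" "z' \<in> V t'" "\<And>f. h (snd p) f + h (snd q) f = f z' - f t'"
        by (auto simp: U_def h_mult)
      \<comment> \<open>The exponent sum is 0: the letters have opposite signs or are both
        neutral.\<close>
      note deg = t'(3)[of "\<lambda>_. 1"]
      have V_t: "openin X (V t)" "V t \<subseteq> topspace X" if "t \<in> topspace X" for t
        using V that openin_subset by (auto simp: nbhd_assignment_def)
      have "\<exists>P Q. openin \<L> P \<and> openin \<L> Q \<and> p \<in> P \<and> q \<in> Q \<and> (\<forall>p'\<in>P. \<forall>q'\<in>Q. snd p' \<otimes> snd q' \<in> U)"
        using pq(1)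
      proof (cases rule: letter_cases)
        case p: (letter z s)
        from pq(2) show ?thesis
        proof (cases rule: letter_cases)
          case q: (letter t u)
          have su: "u \<longleftrightarrow> \<not> s" using deg p q by (auto simp: h_letter split: if_splits)
          show ?thesis
          proof (cases s)
            case True
            then have "z \<in> V t"
              using U[OF pq(3) q(1), of z] pq(1,2) p q su by (simp add: h_mult h_letter)
            \<comment> \<open>The inverse letter is isolated, so \<open>t\<close> stays fixed while
              the positive letter ranges over the open set \<open>V t\<close>.\<close>
            moreover have "snd p' \<otimes> snd q' \<in> U"
              if "p' \<in> letter_nbhd (V t) (t, True)" "q' \<in> letter_nbhd (V t) (t, False)" for p' q'
              using that q(1) V_t[OF q(1)] by (auto simp: letter_nbhd_def h_letter intro!: UI[of _ _ t])
            moreover have "p \<in> letter_nbhd (V t) (t, True)" "q \<in> letter_nbhd (V t) (t, False)"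
              using calculation(1) True su p(2) q(2) by (auto simp: letter_nbhd_def)
            ultimately show ?thesis
              using openin_letter_nbhd[OF V_t(1)[OF q(1)] q(1)] by blast
          next
            case False
            then have "t \<in> V z"
              using U[OF pq(3) p(1), of t] pq(1,2) p q su by (simp add: h_mult h_letter)
            moreover have "snd p' \<otimes> snd q' \<in> U"
              if "p' \<in> letter_nbhd (V z) (z, False)" "q' \<in> letter_nbhd (V z) (z, True)" for p' q'
              using that p(1) V_t[OF p(1)] by (auto simp: letter_nbhd_def h_letter intro!: UI[of _ _ z])
            moreover have "p \<in> letter_nbhd (V z) (z, False)" "q \<in> letter_nbhd (V z) (z, True)"
              using calculation(1) False su p(2) q(2) by (auto simp: letter_nbhd_def)
            ultimately show ?thesis
              using openin_letter_nbhd[OF V_t(1)[OF p(1)] p(1)] by blast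
          qed
        qed (use deg p in \<open>auto simp: h_letter split: if_splits\<close>)
      next
        case p: one
        from pq(2) have "q = letter_e"
          by (cases rule: letter_cases) (use p deg in \<open>auto simp: h_letter split: if_splits\<close>)
        with p pq(3) show ?thesis
          using openin_letter_e by (intro exI[of _ "{letter_e}"]) auto
      qed
      then obtain P Q where PQ: "openin \<L> P" "openin \<L> Q" "p \<in> P" "q \<in> Q" "\<forall>p'\<in>P. \<forall>q'\<in>Q. snd p' \<otimes> snd q' \<in> U"
        by blast
      have "(p', q') \<in> {p \<in> topspace (prod_topology \<L> \<L>). i2 G p \<in> U}" if "p' \<in> P" "q' \<in> Q" for p' q'
        using that PQ(5) subsetD[OF openin_subset[OF PQ(1)] that(1)] subsetD[OF openin_subset[OF PQ(2)] that(2)]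
        by (simp add: i2_apply)
      with PQ show "\<exists>P Q. openin \<L> P \<and> openin \<L> Q \<and> p \<in> P \<and> q \<in> Q \<and>
          P \<times> Q \<subseteq> {p \<in> topspace (prod_topology \<L> \<L>). i2 G p \<in> U}" by blast
    qed
    moreover have "U \<subseteq> topspace (subtopology T S)" by (auto simp: U_def)
    ultimately have "openin (subtopology T S) U" using q unfolding quotient_map_def by blast
    then obtain B where B: "openin T B" "U = B \<inter> S" by (auto simp: openin_subtopology)
    \<comment> \<open>The neutral element lies in \<open>U\<close> through
      \<open>t = z = x0\<close>, which is why the empty space is treated apart.\<close>
    obtain x0 where x0: "x0 \<in> topspace X" using False by blast
    have "snd letter_e \<otimes> snd letter_e \<in> U"
      using x0 nbhd_assignmentD(1)[OF V x0] by (intro UI[of _ _ x0 x0]) (auto simp: topspace_letters)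
    then have one: "(\<one>, \<one>) \<in> {p \<in> topspace (prod_topology T T). (\<lambda>(a, b). a \<otimes> b) p \<in> B}"
      using B by (simp add: topspace_T)
    have "openin (prod_topology T T) {p \<in> topspace (prod_topology T T). (\<lambda>(a, b). a \<otimes> b) p \<in> B}"
      by (rule openin_continuous_map_preimage[OF continuous_mult B(1)])
    from this[unfolded openin_prod_topology_alt, rule_format, OF one]
    obtain P Q where PQ: "openin T P" "openin T Q" "\<one> \<in> P" "\<one> \<in> Q"
      "P \<times> Q \<subseteq> {p \<in> topspace (prod_topology T T). (\<lambda>(a, b). a \<otimes> b) p \<in> B}"
      by blast
    \<comment> \<open>Products of \<open>P\<close> and \<open>Q\<close> lie in \<open>B\<close>. The
      words for a step from \<open>x\<close> to \<open>y\<close> and one from \<open>y\<close> to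
      \<open>z\<close> multiply to the word for \<open>x\<close> and \<open>z\<close>, as the middle
      letters cancel.\<close>
    define W where "W x = {y \<in> topspace X. inv \<iota> x \<otimes> \<iota> y \<in> P \<inter> Q}" for x
    have "nbhd_assignment X W"
      unfolding nbhd_assignment_def W_def
      using PQ by (intro ballI conjI openin_translate) auto
    moreover have "z \<in> V x" if x: "x \<in> topspace X" "y \<in> W x" "z \<in> W y" for x y z
    proof -
      have yz: "y \<in> topspace X" "z \<in> topspace X" using x by (auto simp: W_def)
      have "inv \<iota> x \<otimes> \<iota> y \<in> P" "inv \<iota> y \<otimes> \<iota> z \<in> Q" using x by (auto simp: W_def)
      from subsetD[OF PQ(5) SigmaI[OF this]]
      have "(inv \<iota> x \<otimes> \<iota> y) \<otimes> (inv \<iota> y \<otimes> \<iota> z) \<in> B" by simp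
      moreover have "(inv \<iota> x \<otimes> \<iota> y) \<otimes> (inv \<iota> y \<otimes> \<iota> z) = inv \<iota> x \<otimes> (\<iota> y \<otimes> inv \<iota> y) \<otimes> \<iota> z"
        using x(1) yz by (simp only: m_assoc m_closed inv_closed gen_closed)
      then have "(inv \<iota> x \<otimes> \<iota> y) \<otimes> (inv \<iota> y \<otimes> \<iota> z) = snd (letter (x, False)) \<otimes> snd (letter (z, True))"
        using x(1) yz by (simp add: letter_def)
      ultimately have "snd (letter (x, False)) \<otimes> snd (letter (z, True)) \<in> U"
        using B in_sub[of "letter (x, False)" "letter (z, True)"] x(1) yz by simp
      from U[OF this x(1), of z] show ?thesis
        using x(1) yz by (simp add: h_mult h_letter)
    qed
    ultimately show ?thesis by blast
  qed
qed

lemma i2_in_carrier: "i2 G ` (topspace \<L> \<times> topspace \<L>) \<subseteq> carrier G"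
proof (rule image_subsetI)
  fix r assume "r \<in> topspace \<L> \<times> topspace \<L>"
  then show "i2 G r \<in> carrier G"
    using i2_apply[of "fst r" "snd r"] by (simp add: mem_Times_iff)
qed

lemma closed_imp_quotient:
  assumes "i2 G ` (topspace \<L> \<times> topspace \<L>) = S"
    and "closed_map (prod_topology \<L> \<L>) (subtopology T S) (i2 G)"
  shows "quotient_map (prod_topology \<L> \<L>) (subtopology T S) (i2 G)"
proof (rule continuous_closed_imp_quotient_map)
  have "S \<subseteq> carrier G"
    using assms(1) i2_in_carrier by simp
  then show "i2 G ` topspace (prod_topology \<L> \<L>) = topspace (subtopology T S)"
    using assms(1) by (auto simp: topspace_T)
  then show "continuous_map (prod_topology \<L> \<L>) (subtopology T S) (i2 G)"
    using continuous_i2 by (auto simp: continuous_map_in_subtopology)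
qed (rule assms(2))

section \<open>Closedness through neighbourhoods of fibres\<close>

lemma letter_nbhd_mono: "A \<subseteq> B \<Longrightarrow> letter_nbhd A l \<subseteq> letter_nbhd B l"
  by (auto simp: letter_nbhd_def)

lemma ex_pair_nbhd:
  assumes "openin (prod_topology \<L> \<L>) U" "(letter (x, b), letter (y, c)) \<in> U" "x \<in> topspace X" "y \<in> topspace X"
  obtains A B where "openin X A" "x \<in> A" "openin X B" "y \<in> B" "letter_nbhd A (x, b) \<times> letter_nbhd B (y, c) \<subseteq> U"
proof -
  from assms(1)[unfolded openin_prod_topology_alt, rule_format, OF assms(2)]
  obtain P Q where PQ: "openin \<L> P" "openin \<L> Q" "letter (x, b) \<in> P" "letter (y, c) \<in> Q" "P \<times> Q \<subseteq> U"
    by blast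
  obtain A where A: "openin X A" "x \<in> A" "letter_nbhd A (x, b) \<subseteq> P"
    by (rule ex_letter_nbhd[OF PQ(1,3) assms(3)])
  obtain B where B: "openin X B" "y \<in> B" "letter_nbhd B (y, c) \<subseteq> Q"
    by (rule ex_letter_nbhd[OF PQ(2,4) assms(4)])
  have "letter_nbhd A (x, b) \<times> letter_nbhd B (y, c) \<subseteq> U"
    using Sigma_mono[OF A(3) B(3)] PQ(5) by (rule order_trans)
  with A(1,2) B(1,2) show thesis by (rule that)
qed

text \<open>The hypothesis at \<open>w\<close> of the fibre criterion for closed maps;
  \<open>nbhd_into\<close> is its conclusion, with a neighbourhood in the whole group that is cut
  down to the image only at the end.\<close>

definition fibre_nbhd :: "'g \<Rightarrow> ((nat \<times> 'g) \<times> nat \<times> 'g) set \<Rightarrow> bool" where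
  "fibre_nbhd w U \<longleftrightarrow> openin (prod_topology \<L> \<L>) U \<and>
     (\<forall>p\<in>topspace \<L>. \<forall>q\<in>topspace \<L>. snd p \<otimes> snd q = w \<longrightarrow> (p, q) \<in> U)"

lemma fibre_nbhdD:
  "\<lbrakk>fibre_nbhd w U; p \<in> topspace \<L>; q \<in> topspace \<L>; snd p \<otimes> snd q = w\<rbrakk> \<Longrightarrow> (p, q) \<in> U"
  by (simp add: fibre_nbhd_def)

definition nbhd_into :: "'g \<Rightarrow> ((nat \<times> 'g) \<times> nat \<times> 'g) set \<Rightarrow> bool" where
  "nbhd_into w U \<longleftrightarrow> (\<exists>W. openin T W \<and> w \<in> W \<and>
     (\<forall>p\<in>topspace \<L>. \<forall>q\<in>topspace \<L>. snd p \<otimes> snd q \<in> W \<longrightarrow> (p, q) \<in> U))"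

text \<open>The fibre contains each point paired with its inverse, in both orders. As inverse
  letters are isolated, \<open>U\<close> lets the positive letter move in a neighbourhood of the
  point; these form the assignment to which normality is applied.\<close>

lemma nbhd_into_one:
  assumes N: "all_normal X" and U: "fibre_nbhd \<one> U"
  shows "nbhd_into \<one> U"
proof -
  have "\<forall>x\<in>topspace X. \<exists>A. openin X A \<and> x \<in> A \<and>
      (\<forall>y\<in>A. (letter (x, False), letter (y, True)) \<in> U \<and> (letter (y, True), letter (x, False)) \<in> U)"
  proof
    fix x assume x: "x \<in> topspace X"
    have "snd (letter (x, b)) \<otimes> snd (letter (x, \<not> b)) = \<one>" for b
      using x by (simp add: letter_def)
    then have mem: "(letter (x, b), letter (x, \<not> b)) \<in> U" for b
      using x by (intro fibre_nbhdD[OF U]) simp_all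
    have U': "openin (prod_topology \<L> \<L>) U" using U by (simp add: fibre_nbhd_def)
    obtain A' A where A: "openin X A'" "x \<in> A'" "openin X A" "x \<in> A"
      "letter_nbhd A' (x, False) \<times> letter_nbhd A (x, True) \<subseteq> U"
      by (rule ex_pair_nbhd[OF U' mem[of False, simplified] x x])
    obtain B B' where B: "openin X B" "x \<in> B" "openin X B'" "x \<in> B'"
      "letter_nbhd B (x, True) \<times> letter_nbhd B' (x, False) \<subseteq> U"
      by (rule ex_pair_nbhd[OF U' mem[of True, simplified] x x])
    show "\<exists>A. openin X A \<and> x \<in> A \<and>
      (\<forall>y\<in>A. (letter (x, False), letter (y, True)) \<in> U \<and> (letter (y, True), letter (x, False)) \<in> U)"
      using A B by (intro exI[of _ "A \<inter> B"]) (auto simp: letter_nbhd_def)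
  qed
  then obtain V where V: "\<forall>x\<in>topspace X. openin X (V x) \<and> x \<in> V x \<and>
      (\<forall>y\<in>V x. (letter (x, False), letter (y, True)) \<in> U \<and> (letter (y, True), letter (x, False)) \<in> U)"
    by (rule bchoice[THEN exE])
  then have "nbhd_assignment X V" by (simp add: nbhd_assignment_def)
  then obtain W where W: "openin T W" "\<one> \<in> W"
    "\<And>p q. \<lbrakk>p \<in> topspace \<L>; q \<in> topspace \<L>; snd p \<otimes> snd q \<in> W\<rbrakk> \<Longrightarrow>
       (p, q) = (letter_e, letter_e) \<or>
       (\<exists>x\<in>topspace X. \<exists>y\<in>V x. (p, q) = (letter (x, False), letter (y, True)) \<or> (p, q) = (letter (y, True), letter (x, False)))"
    using neighbourhood_one[OF N] by blast
  have "(letter_e, letter_e) \<in> U"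
    using U by (simp add: fibre_nbhd_def topspace_letters)
  then have "(p, q) \<in> U" if "p \<in> topspace \<L>" "q \<in> topspace \<L>" "snd p \<otimes> snd q \<in> W" for p q
    using W(3)[OF that] V by auto
  with W(1,2) show ?thesis unfolding nbhd_into_def by blast
qed

text \<open>The fibre contains the letter with the neutral letter on either side. The neutral letter
  is isolated, so one set \<open>A\<close> can serve both placements.\<close>

lemma nbhd_into_letter:
  assumes t1: "t1_space X" and x: "x \<in> topspace X" and U: "fibre_nbhd (snd (letter (x, b))) U"
  shows "nbhd_into (snd (letter (x, b))) U"
proof -
  let ?w = "snd (letter (x, b))"
  have w: "?w \<in> carrier G" using x by (rule snd_letter_closed[OF letter_in_letters])
  have e: "letter_e \<in> topspace \<L>" by (simp add: topspace_letters)
  have U': "openin (prod_topology \<L> \<L>) U" and mem: "(letter (x, b), letter_e) \<in> U" "(letter_e, letter (x, b)) \<in> U"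
    using U w x e unfolding fibre_nbhd_def by auto
  obtain P Q where PQ: "openin \<L> P" "letter (x, b) \<in> P" "letter_e \<in> Q" "P \<times> Q \<subseteq> U"
    using U' mem(1) unfolding openin_prod_topology_alt by blast
  obtain P' Q' where PQ': "openin \<L> P'" "letter (x, b) \<in> P'" "letter_e \<in> Q'" "Q' \<times> P' \<subseteq> U"
    using U' mem(2) unfolding openin_prod_topology_alt by blast
  have "openin \<L> (P \<inter> P')" "letter (x, b) \<in> P \<inter> P'" using PQ PQ' by auto
  then obtain A where A: "openin X A" "x \<in> A" "letter_nbhd A (x, b) \<subseteq> P \<inter> P'"
    using ex_letter_nbhd x by metis
  obtain W where W: "openin T W" "?w \<in> W"
    "\<And>p q. \<lbrakk>p \<in> topspace \<L>; q \<in> topspace \<L>; snd p \<otimes> snd q \<in> W\<rbrakk> \<Longrightarrow>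
       (p, q) \<in> letter_nbhd A (x, b) \<times> {letter_e} \<union> {letter_e} \<times> letter_nbhd A (x, b)"
    using neighbourhood_single[OF t1 w x A(1,2) h_letter[OF x]] by blast
  have "(p, q) \<in> U" if "p \<in> topspace \<L>" "q \<in> topspace \<L>" "snd p \<otimes> snd q \<in> W" for p q
    using W(3)[OF that] A(3) PQ(3,4) PQ'(3,4) by blast
  with W(1,2) show ?thesis unfolding nbhd_into_def by blast
qed

text \<open>The neutral element and single letters are handled alike in both groups. For uncancelled
  pairs the fibre depends on commutativity, hence the hypothesis \<open>pair\<close>.\<close>

lemma all_normal_imp_closed:
  assumes "t1_space X" "all_normal X" "i2 G ` (topspace \<L> \<times> topspace \<L>) = S"
    and pair: "\<And>x b y c U. \<lbrakk>x \<in> topspace X; y \<in> topspace X; (y, c) \<noteq> flip (x, b);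
      fibre_nbhd (snd (letter (x, b)) \<otimes> snd (letter (y, c))) U\<rbrakk> \<Longrightarrow>
      nbhd_into (snd (letter (x, b)) \<otimes> snd (letter (y, c))) U"
  shows "closed_map (prod_topology \<L> \<L>) (subtopology T S) (i2 G)"
  unfolding closed_map_fibre_neighbourhood
proof (intro conjI allI impI)
  have S: "S \<subseteq> carrier G"
    using assms(3) i2_in_carrier by simp
  then show "i2 G \<in> topspace (prod_topology \<L> \<L>) \<rightarrow> topspace (subtopology T S)"
    using assms(3) by (auto simp: topspace_T)
  fix U w
  assume "openin (prod_topology \<L> \<L>) U \<and> w \<in> topspace (subtopology T S) \<and>
    {p \<in> topspace (prod_topology \<L> \<L>). i2 G p = w} \<subseteq> U"
  then have U: "fibre_nbhd w U" and "w \<in> S"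
    by (auto simp: fibre_nbhd_def i2_apply[symmetric])
  then obtain p q where pq: "p \<in> topspace \<L>" "q \<in> topspace \<L>" "w = snd p \<otimes> snd q"
    using assms(3) by (force simp: i2_apply)
  have "nbhd_into w U"
    using pq(1)
  proof (cases rule: letter_cases)
    case p: (letter x b)
    from pq(2) show ?thesis
    proof (cases rule: letter_cases)
      case q: (letter y c)
      show ?thesis
      proof (cases "(y, c) = flip (x, b)")
        case True
        then have "w = \<one>" using pq(3) p q by (cases b) (auto simp: flip_def letter_def)
        then show ?thesis using nbhd_into_one assms(2) U by blast
      next
        case False
        then show ?thesis using pair[OF p(1) q(1) False] U pq p q by simp
      qed
    next
      case one
      then have "w = snd (letter (x, b))" using pq p by simp
      then show ?thesis using nbhd_into_letter[OF assms(1) p(1)] U by simp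
    qed
  next
    case p: one
    from pq(2) show ?thesis
    proof (cases rule: letter_cases)
      case q: (letter y c)
      then have "w = snd (letter (y, c))" using pq p by simp
      then show ?thesis using nbhd_into_letter[OF assms(1) q(1)] U by simp
    next
      case one
      then show ?thesis using nbhd_into_one[OF assms(2)] U p pq by simp
    qed
  qed
  then obtain W where W: "openin T W" "w \<in> W"
    "\<forall>p\<in>topspace \<L>. \<forall>q\<in>topspace \<L>. snd p \<otimes> snd q \<in> W \<longrightarrow> (p, q) \<in> U"
    unfolding nbhd_into_def by blast
  then show "\<exists>V. openin (subtopology T S) V \<and> w \<in> V \<and> {p \<in> topspace (prod_topology \<L> \<L>). i2 G p \<in> V} \<subseteq> U"
    using \<open>w \<in> S\<close> by (intro exI[of _ "W \<inter> S"]) (auto simp: openin_subtopology i2_apply)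
qed

lemma neighbourhood_pair_mem:
  assumes t1: "t1_space X" and xy: "x \<in> topspace X" "y \<in> topspace X" "(y, c) \<noteq> flip (x, b)"
    and AB: "openin X A" "x \<in> A" "openin X B" "y \<in> B"
  obtains W where "openin T W" "snd (letter (x, b)) \<otimes> snd (letter (y, c)) \<in> W"
    "\<And>p q. \<lbrakk>p \<in> topspace \<L>; q \<in> topspace \<L>; snd p \<otimes> snd q \<in> W\<rbrakk> \<Longrightarrow>
       (p, q) \<in> letter_nbhd A (x, b) \<times> letter_nbhd B (y, c) \<union> letter_nbhd B (y, c) \<times> letter_nbhd A (x, b)"
proof -
  have cl: "snd (letter (x, b)) \<in> carrier G" "snd (letter (y, c)) \<in> carrier G"
    using xy by (simp_all del: snd_letter_closed add: snd_letter_closed[OF letter_in_letters])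
  then have "h (snd (letter (x, b)) \<otimes> snd (letter (y, c))) f = (if b then f x else - f x) + (if c then f y else - f y)" for f
    using xy by (simp add: h_mult h_letter)
  from neighbourhood_pair[OF t1 m_closed[OF cl] xy(1,2) AB xy(3) this] that show thesis
    by blast
qed

text \<open>Both orders of the letters lie in the fibre, so the neighbourhoods shrink until both
  rectangles lie in \<open>U\<close>; the order, which the real-valued tests leave open, is then
  harmless.\<close>

lemma nbhd_into_pair_commutative:
  assumes comm: "\<And>a b. \<lbrakk>a \<in> carrier G; b \<in> carrier G\<rbrakk> \<Longrightarrow> a \<otimes> b = b \<otimes> a" and t1: "t1_space X"
    and xy: "x \<in> topspace X" "y \<in> topspace X" "(y, c) \<noteq> flip (x, b)"
    and U: "fibre_nbhd (snd (letter (x, b)) \<otimes> snd (letter (y, c))) U"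
  shows "nbhd_into (snd (letter (x, b)) \<otimes> snd (letter (y, c))) U"
proof -
  have U': "openin (prod_topology \<L> \<L>) U" and mem: "(letter (x, b), letter (y, c)) \<in> U" "(letter (y, c), letter (x, b)) \<in> U"
    using U xy comm[of "snd (letter (x, b))" "snd (letter (y, c))"] unfolding fibre_nbhd_def by auto
  obtain A B where AB: "openin X A" "x \<in> A" "openin X B" "y \<in> B" "letter_nbhd A (x, b) \<times> letter_nbhd B (y, c) \<subseteq> U"
    using ex_pair_nbhd[OF U' mem(1) xy(1,2)] by metis
  obtain A' B' where AB': "openin X A'" "x \<in> A'" "openin X B'" "y \<in> B'" "letter_nbhd B' (y, c) \<times> letter_nbhd A' (x, b) \<subseteq> U"
    using ex_pair_nbhd[OF U' mem(2) xy(2,1)] by metis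
  have "openin X (A \<inter> A')" "x \<in> A \<inter> A'" "openin X (B \<inter> B')" "y \<in> B \<inter> B'"
    using AB AB' by auto
  from neighbourhood_pair_mem[OF t1 xy this] obtain W where W: "openin T W" "snd (letter (x, b)) \<otimes> snd (letter (y, c)) \<in> W"
    "\<And>p q. \<lbrakk>p \<in> topspace \<L>; q \<in> topspace \<L>; snd p \<otimes> snd q \<in> W\<rbrakk> \<Longrightarrow>
       (p, q) \<in> letter_nbhd (A \<inter> A') (x, b) \<times> letter_nbhd (B \<inter> B') (y, c) \<union>
         letter_nbhd (B \<inter> B') (y, c) \<times> letter_nbhd (A \<inter> A') (x, b)"
    by metis
  have "letter_nbhd (A \<inter> A') (x, b) \<times> letter_nbhd (B \<inter> B') (y, c) \<union>
      letter_nbhd (B \<inter> B') (y, c) \<times> letter_nbhd (A \<inter> A') (x, b) \<subseteq> U"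
    using AB(5) AB'(5) letter_nbhd_mono[of "A \<inter> A'" A "(x, b)"] letter_nbhd_mono[of "A \<inter> A'" A' "(x, b)"]
      letter_nbhd_mono[of "B \<inter> B'" B "(y, c)"] letter_nbhd_mono[of "B \<inter> B'" B' "(y, c)"] by blast
  with W show ?thesis unfolding nbhd_into_def by blast
qed

end

section \<open>The Abelian case\<close>

text \<open>The reduced length in the free Abelian group, as in \<open>AP_upto\<close>.\<close>

definition frag_norm :: "('a \<Rightarrow>\<^sub>0 int) \<Rightarrow> nat" where
  "frag_norm a = (\<Sum>x \<in> Poly_Mapping.keys a. nat \<bar>Poly_Mapping.lookup a x\<bar>)"

lemma frag_norm_superset:
  assumes "finite S" "Poly_Mapping.keys a \<subseteq> S"
  shows "frag_norm a = (\<Sum>x\<in>S. nat \<bar>Poly_Mapping.lookup a x\<bar>)"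
  unfolding frag_norm_def using assms
  by (intro sum.mono_neutral_left) (auto simp: in_keys_iff)

lemma frag_norm_add: "frag_norm (a + b) \<le> frag_norm a + frag_norm b"
proof -
  let ?S = "Poly_Mapping.keys a \<union> Poly_Mapping.keys b"
  have "frag_norm (a + b) = (\<Sum>x\<in>?S. nat \<bar>Poly_Mapping.lookup (a + b) x\<bar>)"
    by (intro frag_norm_superset) (auto simp: keys_add)
  also have "\<dots> \<le> (\<Sum>x\<in>?S. nat \<bar>Poly_Mapping.lookup a x\<bar> + nat \<bar>Poly_Mapping.lookup b x\<bar>)"
    by (intro sum_mono) (simp add: lookup_add)
  also have "\<dots> = frag_norm a + frag_norm b"
    by (simp add: sum.distrib frag_norm_superset[of ?S])
  finally show ?thesis .
qed

lemma frag_norm_simps [simp]: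
  "frag_norm 0 = 0" "frag_norm (frag_of x) = 1" "frag_norm (- a) = frag_norm a"
  by (simp_all add: frag_norm_def)

text \<open>Subtracting a generator that occurs, with the sign of its coefficient, lowers one
  absolute value by 1 and keeps the others.\<close>

lemma frag_norm_peel:
  assumes "a \<noteq> 0"
  obtains x b where "x \<in> Poly_Mapping.keys a" "b \<in> {frag_of x, - frag_of x}" "frag_norm (a - b) < frag_norm a"
proof -
  obtain x where x: "x \<in> Poly_Mapping.keys a"
    using assms keys_eq_empty by blast
  define b where "b = (if Poly_Mapping.lookup a x > 0 then frag_of x else - frag_of x)"
  have b: "Poly_Mapping.lookup b y = (if y = x then if Poly_Mapping.lookup a x > 0 then 1 else -1 else 0)" for y
    by (auto simp: b_def lookup_single when_def)
  have "Poly_Mapping.keys (a - b) \<subseteq> Poly_Mapping.keys a"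
    using x by (auto simp: in_keys_iff lookup_minus b split: if_splits)
  then have "frag_norm (a - b) = (\<Sum>y\<in>Poly_Mapping.keys a. nat \<bar>Poly_Mapping.lookup (a - b) y\<bar>)"
    by (intro frag_norm_superset) auto
  also have "\<dots> < frag_norm a"
    unfolding frag_norm_def
    using x by (intro sum_strict_mono_ex1 bexI[of _ x]) (auto simp: lookup_minus b in_keys_iff)
  finally show thesis using x by (intro that[of x b]) (auto simp: b_def)
qed

lemma is_AP_free_paratopological:
  assumes "is_AP X T"
  obtains h where "free_paratopological comm_group X frag_of (free_Abelian_group (topspace X)) T h"
proof -
  obtain h where "h \<in> hom (free_Abelian_group (topspace X)) pointwise_group"
    "\<forall>x\<in>topspace X. h (frag_of x) = (\<lambda>f :: 'a \<Rightarrow> real. f x)"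
    using free_Abelian_group_universal'[OF comm_group_pointwise, of "\<lambda>x f. f x" "topspace X"] by auto
  then show thesis
    using assms by (intro that[of h]) (simp add: free_paratopological_def is_AP_def)
qed

lemma AP_two_letters:
  assumes "is_AP X T"
  shows "i2 (free_Abelian_group (topspace X)) ` (topspace (AP_letters X T) \<times> topspace (AP_letters X T)) = AP_upto 2 X"
proof -
  obtain h where "free_paratopological comm_group X frag_of (free_Abelian_group (topspace X)) T h"
    using is_AP_free_paratopological[OF assms] by blast
  then interpret free_paratopological comm_group X frag_of "free_Abelian_group (topspace X)" T h .
  have upto: "AP_upto n X = {a. Poly_Mapping.keys a \<subseteq> topspace X \<and> frag_norm a \<le> n}" for n
    by (auto simp: AP_upto_def frag_norm_def)
  have letter: "snd (letter (x, b)) = (if b then frag_of x else - frag_of x)" if "x \<in> topspace X" for x b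
    using that by (simp add: letter_def)
  have norm: "frag_norm (snd p) \<le> 1" if "p \<in> topspace \<L>" for p
    using that by (cases rule: letter_cases) (auto simp: letter)
  \<comment> \<open>Letters are removed one at a time; at zero the neutral letter is removed, which
    pads short words.\<close>
  have peel: "\<exists>p\<in>topspace \<L>. a - snd p \<in> AP_upto n X" if "a \<in> AP_upto (Suc n) X" for a n
  proof (cases "a = 0")
    case True
    then show ?thesis by (intro bexI[of _ "(2, 0)"]) (auto simp: upto topspace_letters)
  next
    case False
    obtain x b where x: "x \<in> Poly_Mapping.keys a" "b \<in> {frag_of x, - frag_of x}" "frag_norm (a - b) < frag_norm a"
      by (rule frag_norm_peel[OF False])
    have X: "x \<in> topspace X" using x(1) that by (auto simp: upto)
    have "Poly_Mapping.keys (a - b) \<subseteq> topspace X"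
      using that x(2) X keys_diff[of a b] by (auto simp: upto)
    then have "a - b \<in> AP_upto n X" using x(3) that by (auto simp: upto)
    moreover have "b = snd (letter (x, b = frag_of x))"
      using x(2) X letter by auto
    ultimately show ?thesis using X by (intro bexI[of _ "letter (x, b = frag_of x)"]) auto
  qed
  show ?thesis
  proof (intro equalityI subsetI)
    fix w assume "w \<in> i2 (free_Abelian_group (topspace X)) ` (topspace \<L> \<times> topspace \<L>)"
    then obtain p q where pq: "p \<in> topspace \<L>" "q \<in> topspace \<L>" "w = snd p + snd q"
      by (auto simp: i2_def)
    then show "w \<in> AP_upto 2 X"
      using norm[OF pq(1)] norm[OF pq(2)] frag_norm_add[of "snd p" "snd q"] snd_letter_closed[OF pq(1)] snd_letter_closed[OF pq(2)]
        keys_add[of "snd p" "snd q"] by (auto simp: upto)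
  next
    fix w assume "w \<in> AP_upto 2 X"
    then obtain p where p: "p \<in> topspace \<L>" "w - snd p \<in> AP_upto 1 X"
      using peel[of w 1] by (auto simp: numeral_2_eq_2)
    then obtain q where q: "q \<in> topspace \<L>" "w - snd p - snd q \<in> AP_upto 0 X"
      using peel[of "w - snd p" 0] by auto
    have "frag_norm (w - snd p - snd q) = 0" using q(2) unfolding upto by simp
    then have "w - snd p - snd q = 0" by (metis frag_norm_peel not_less_zero)
    then have "w = i2 (free_Abelian_group (topspace X)) (p, q)" by (simp add: i2_apply algebra_simps)
    then show "w \<in> i2 (free_Abelian_group (topspace X)) ` (topspace \<L> \<times> topspace \<L>)"
      using p q by blast
  qed
qed

text \<open>A circle: normality gives a closed map, a closed map onto the image is quotient, and a
  quotient map gives normality.\<close>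

lemma AP_equivalence:
  assumes "t1_space X" "is_AP X T"
  shows "quotient_map (prod_topology (AP_letters X T) (AP_letters X T))
        (subtopology T (AP_upto 2 X)) (i2 (free_Abelian_group (topspace X))) \<longleftrightarrow> all_normal X"
    and "closed_map (prod_topology (AP_letters X T) (AP_letters X T))
        (subtopology T (AP_upto 2 X)) (i2 (free_Abelian_group (topspace X))) \<longleftrightarrow> all_normal X"
proof -
  obtain h where "free_paratopological comm_group X frag_of (free_Abelian_group (topspace X)) T h"
    using is_AP_free_paratopological[OF assms(2)] by blast
  then interpret free_paratopological comm_group X frag_of "free_Abelian_group (topspace X)" T h .
  note two = AP_two_letters[OF assms(2)]
  have "closed_map (prod_topology \<L> \<L>) (subtopology T (AP_upto 2 X)) (i2 (free_Abelian_group (topspace X)))"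
    if "all_normal X"
    using assms(1) that two
    by (rule all_normal_imp_closed) (rule nbhd_into_pair_commutative, simp_all add: add.commute assms)
  then show "quotient_map (prod_topology \<L> \<L>) (subtopology T (AP_upto 2 X)) (i2 (free_Abelian_group (topspace X)))
      \<longleftrightarrow> all_normal X"
    and "closed_map (prod_topology \<L> \<L>) (subtopology T (AP_upto 2 X)) (i2 (free_Abelian_group (topspace X)))
      \<longleftrightarrow> all_normal X"
    using quotient_imp_all_normal closed_imp_quotient[OF two] by blast+
qed


section \<open>The non-Abelian case\<close>

text \<open>Any homomorphism to the integers turns a group, Abelian or not, into a paratopological group:
  it orders the group by \<open>a < b\<close> iff \<^term>\<open>\<delta> a < \<delta> b\<close>, and the upsets are open. Mapping \<open>X\<close> to the free group
  on two generators with this topology separates \<open>xy\<close> from \<open>yx\<close>, which no Abelian test group can do.\<close>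

definition lex_topology :: "('h, 'm) monoid_scheme \<Rightarrow> ('h \<Rightarrow> int) \<Rightarrow> 'h topology" where
  "lex_topology H \<delta> = topology (\<lambda>U. U \<subseteq> carrier H \<and> (\<forall>a\<in>U. \<forall>b\<in>carrier H. \<delta> a < \<delta> b \<longrightarrow> b \<in> U))"

lemma openin_lex_topology:
  "openin (lex_topology H \<delta>) U \<longleftrightarrow> U \<subseteq> carrier H \<and> (\<forall>a\<in>U. \<forall>b\<in>carrier H. \<delta> a < \<delta> b \<longrightarrow> b \<in> U)"
proof -
  have "istopology (\<lambda>U. U \<subseteq> carrier H \<and> (\<forall>a\<in>U. \<forall>b\<in>carrier H. \<delta> a < \<delta> b \<longrightarrow> b \<in> U))"
    unfolding istopology_def by blast
  then show ?thesis by (simp add: lex_topology_def)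
qed

lemma topspace_lex_topology [simp]: "topspace (lex_topology H \<delta>) = carrier H"
proof -
  have "openin (lex_topology H \<delta>) (carrier H)" by (simp add: openin_lex_topology)
  moreover have "topspace (lex_topology H \<delta>) \<subseteq> carrier H"
    using openin_topspace[of "lex_topology H \<delta>"] unfolding openin_lex_topology by blast
  ultimately show ?thesis using openin_subset by blast
qed

lemma openin_lex_topology_upset:
  "openin (lex_topology H \<delta>) {b \<in> carrier H. b = a \<or> \<delta> a < \<delta> b}"
  by (auto simp: openin_lex_topology)

text \<open>A product of points from the minimal neighbourhoods of \<open>a\<close> and
  \<open>b\<close> is either the product of \<open>a\<close> and \<open>b\<close> itself or has
  strictly larger \<delta>.\<close>

lemma paratopological_group_lex:
  assumes "group H" "\<delta> \<in> hom H integer_group"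
  shows "paratopological_group H (lex_topology H \<delta>)"
proof -
  interpret H: group H by fact
  have \<delta>: "\<delta> (a \<otimes>\<^bsub>H\<^esub> b) = \<delta> a + \<delta> b" if "a \<in> carrier H" "b \<in> carrier H" for a b
    using assms(2) that by (simp add: hom_def integer_group_def)
  let ?T = "lex_topology H \<delta>"
  have "openin (prod_topology ?T ?T) {p \<in> topspace (prod_topology ?T ?T). (\<lambda>(a, b). a \<otimes>\<^bsub>H\<^esub> b) p \<in> U}"
    if U: "openin ?T U" for U
    unfolding openin_prod_topology_alt
  proof (intro allI impI)
    fix a b assume "(a, b) \<in> {p \<in> topspace (prod_topology ?T ?T). (\<lambda>(a, b). a \<otimes>\<^bsub>H\<^esub> b) p \<in> U}"
    then have ab: "a \<in> carrier H" "b \<in> carrier H" "a \<otimes>\<^bsub>H\<^esub> b \<in> U" by auto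
    let ?B = "\<lambda>a. {b \<in> carrier H. b = a \<or> \<delta> a < \<delta> b}"
    have "a' \<otimes>\<^bsub>H\<^esub> b' \<in> U" if "a' \<in> ?B a" "b' \<in> ?B b" for a' b'
    proof (cases "a' = a \<and> b' = b")
      case False
      then have "\<delta> (a \<otimes>\<^bsub>H\<^esub> b) < \<delta> (a' \<otimes>\<^bsub>H\<^esub> b')" using that ab by (auto simp: \<delta>)
      moreover have "a' \<otimes>\<^bsub>H\<^esub> b' \<in> carrier H" using that by simp
      ultimately show ?thesis using U ab(3) unfolding openin_lex_topology by blast
    qed (use ab in simp)
    then have "?B a \<times> ?B b \<subseteq> {p \<in> topspace (prod_topology ?T ?T). (\<lambda>(a, b). a \<otimes>\<^bsub>H\<^esub> b) p \<in> U}" by auto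
    moreover have "openin ?T (?B a)" "openin ?T (?B b)" "a \<in> ?B a" "b \<in> ?B b"
      using ab openin_lex_topology_upset by auto
    ultimately show "\<exists>A B. openin ?T A \<and> openin ?T B \<and> a \<in> A \<and> b \<in> B \<and>
        A \<times> B \<subseteq> {p \<in> topspace (prod_topology ?T ?T). (\<lambda>(a, b). a \<otimes>\<^bsub>H\<^esub> b) p \<in> U}" by blast
  qed
  then show ?thesis
    using assms(1) by (auto simp: paratopological_group_def continuous_map_def)
qed

text \<open>The value on one letter of the homomorphism sending the generator \<open>True\<close> to
  1 and \<open>False\<close> to 0; \<open>True\<close> will stand for the points of an open
  set.\<close>

fun letter_value :: "bool \<times> bool \<Rightarrow> int" where
  "letter_value (a, b) = (if a then if b then 1 else -1 else 0)"

text \<open>Replacing points by their membership in \<open>A\<close> extends to a continuous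
  homomorphism into the free group on two generators. \<open>W\<close> is the preimage of the
  minimal neighbourhood of the image of the word: the image stays the same unless its value
  rises.\<close>

lemma FP_order_neighbourhood:
  assumes FP: "is_FP X T" and A: "openin X A" and xy: "x \<in> topspace X" "y \<in> topspace X"
  obtains W where "openin T W" "push (x, b) [(y, c)] \<in> W"
    "\<And>z s t u. \<lbrakk>z \<in> topspace X; t \<in> topspace X; push (z, s) [(t, u)] \<in> W\<rbrakk> \<Longrightarrow>
       push (z \<in> A, s) [(t \<in> A, u)] = push (x \<in> A, b) [(y \<in> A, c)] \<or>
       letter_value (x \<in> A, b) + letter_value (y \<in> A, c) < letter_value (z \<in> A, s) + letter_value (t \<in> A, u)"
proof -
  let ?G = "free_group (topspace X)" and ?H = "free_group (UNIV :: bool set)"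
  interpret G: group ?G by (rule group_free_group)
  interpret H: group ?H by (rule group_free_group)
  interpret Z: group integer_group by (rule group_integer_group)
  obtain \<delta> where \<delta>: "\<delta> \<in> hom ?H integer_group" "\<And>a. \<delta> (free_gen a) = of_bool a"
    using free_group_universal[of integer_group "of_bool" UNIV] by auto
  let ?f = "\<lambda>x. free_gen (x \<in> A) :: (bool \<times> bool) list"
  have "continuous_map X (lex_topology ?H \<delta>) ?f"
    unfolding continuous_map_def
  proof (intro conjI allI impI)
    fix U assume U: "openin (lex_topology ?H \<delta>) U"
    have "free_gen True \<in> carrier ?H" by (simp add: free_gen_def)
    \<comment> \<open>An open set containing the generator of value 0 contains the one of value 1,
      so preimages are the whole space, \<open>A\<close> or empty.\<close>
    then have "free_gen False \<in> U \<longrightarrow> free_gen True \<in> U"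
      using U \<delta>(2)[of False] \<delta>(2)[of True] unfolding openin_lex_topology by fastforce
    moreover have "?f x \<in> U \<longleftrightarrow> (if x \<in> A then free_gen True \<in> U else free_gen False \<in> U)" for x
      by (cases "x \<in> A") auto
    ultimately have "{x \<in> topspace X. ?f x \<in> U} =
        (if free_gen False \<in> U then topspace X else if free_gen True \<in> U then A else {})"
      using openin_subset[OF A] by auto
    then show "openin X {x \<in> topspace X. ?f x \<in> U}" using A by simp
  qed (simp add: free_gen_def)
  then obtain \<phi> where \<phi>: "\<phi> \<in> hom ?G ?H" "continuous_map T (lex_topology ?H \<delta>) \<phi>"
      "\<And>x. x \<in> topspace X \<Longrightarrow> \<phi> (free_gen x) = ?f x"
    using is_FP_universal[OF FP paratopological_group_lex[OF group_free_group \<delta>(1)]] by blast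
  interpret \<phi>: group_hom ?G ?H \<phi> by unfold_locales (rule \<phi>(1))
  interpret \<delta>: group_hom ?H integer_group \<delta> by unfold_locales (rule \<delta>(1))
  have \<phi>1: "\<phi> [(z, s)] = [(z \<in> A, s)]" if "z \<in> topspace X" for z s
  proof (cases s)
    case True
    with \<phi>(3)[OF that] show ?thesis by (simp add: free_gen_def)
  next
    case False
    have "free_gen z \<in> carrier ?G" using that by (simp add: free_gen_def)
    then have "\<phi> (inv\<^bsub>?G\<^esub> free_gen z) = inv\<^bsub>?H\<^esub> free_gen (z \<in> A)"
      using \<phi>.hom_inv \<phi>(3)[OF that] by simp
    with False show ?thesis by (simp only: inv_free_gen[OF that] inv_free_gen[OF UNIV_I])
  qed
  have \<delta>1: "\<delta> [(a, s)] = letter_value (a, s)" for a s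
  proof (cases s)
    case True
    with \<delta>(2)[of a] show ?thesis by (simp add: free_gen_def)
  next
    case False
    have "free_gen a \<in> carrier ?H" by (simp add: free_gen_def)
    then have "\<delta> (inv\<^bsub>?H\<^esub> free_gen a) = - of_bool a"
      using \<delta>.hom_inv \<delta>(2)[of a] by simp
    with False show ?thesis by (simp add: inv_free_gen)
  qed
  have \<phi>2: "\<phi> (push (z, s) [(t, u)]) = push (z \<in> A, s) [(t \<in> A, u)]" if "z \<in> topspace X" "t \<in> topspace X" for z s t u
    using \<phi>.hom_mult[of "[(z, s)]" "[(t, u)]"] that by (simp add: \<phi>1)
  have \<delta>2: "\<delta> (push (a, s) [(b, u)]) = letter_value (a, s) + letter_value (b, u)" for a s b u
    using \<delta>.hom_mult[of "[(a, s)]" "[(b, u)]"] by (simp add: \<delta>1 integer_group_def)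
  have topT: "topspace T = carrier ?G"
    using FP by (simp add: is_FP_def free_paratopological_group_def paratopological_group_def)
  define w where "w = push (x, b) [(y, c)]"
  have w: "w \<in> carrier ?G"
    using G.m_closed[of "[(x, b)]" "[(y, c)]"] xy by (simp add: w_def)
  let ?W = "{w' \<in> topspace T. \<phi> w' \<in> {v \<in> carrier ?H. v = \<phi> w \<or> \<delta> (\<phi> w) < \<delta> v}}"
  have "openin T ?W"
    by (rule openin_continuous_map_preimage[OF \<phi>(2) openin_lex_topology_upset])
  moreover have "w \<in> ?W" using w topT \<phi>.hom_closed[OF w] by simp
  ultimately show thesis
    using xy by (intro that[of ?W]) (auto simp: w_def \<phi>2 \<delta>2 simp del: letter_value.simps)
qed

section \<open>Closedness for the free paratopological group\<close>

lemma is_FP_free_paratopological: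
  assumes "is_FP X T"
  obtains h where "free_paratopological group X free_gen (free_group (topspace X)) T h"
proof -
  obtain h where "h \<in> hom (free_group (topspace X)) pointwise_group"
    "\<forall>x\<in>topspace X. h (free_gen x) = (\<lambda>f :: 'a \<Rightarrow> real. f x)"
    using free_group_universal[OF group_pointwise, of "\<lambda>x f. f x" "topspace X"] by auto
  then show thesis
    using assms by (intro that[of h]) (simp add: free_paratopological_def is_FP_def)
qed

lemma FP_equivalence:
  assumes t1: "t1_space X" and FP: "is_FP X T"
  shows "quotient_map (prod_topology (FP_letters X T) (FP_letters X T))
        (subtopology T (FP_upto 2 X)) (i2 (free_group (topspace X))) \<longleftrightarrow> all_normal X"
    and "closed_map (prod_topology (FP_letters X T) (FP_letters X T))
        (subtopology T (FP_upto 2 X)) (i2 (free_group (topspace X))) \<longleftrightarrow> all_normal X"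
proof -
  obtain h where "free_paratopological group X free_gen (free_group (topspace X)) T h"
    using is_FP_free_paratopological[OF FP] by blast
  then interpret free_paratopological group X free_gen "free_group (topspace X)" T h .
  have letter: "snd (letter (x, b)) = [(x, b)]" if "x \<in> topspace X" for x b
    using that inv_free_gen[OF that] by (simp add: letter_def free_gen_def)
  have two: "i2 (free_group (topspace X)) ` (topspace \<L> \<times> topspace \<L>) = FP_upto 2 X"
  proof (intro equalityI subsetI)
    fix w assume w: "w \<in> i2 (free_group (topspace X)) ` (topspace \<L> \<times> topspace \<L>)"
    then obtain p q where pq: "p \<in> topspace \<L>" "q \<in> topspace \<L>" "w = foldr push (snd p) (snd q)"
      by (auto simp: i2_def)
    have "length (snd p) \<le> 1" "length (snd q) \<le> 1"
      using pq(1,2) by (auto elim!: letter_cases simp: letter)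
    then have "length w \<le> 2"
      unfolding pq(3) by (cases "snd p"; cases "snd q") (auto simp: push_def)
    then show "w \<in> FP_upto 2 X"
      using w i2_in_carrier unfolding FP_upto_def by blast
  next
    fix w assume w: "w \<in> FP_upto 2 X"
    have e: "(2, []) \<in> topspace \<L>" using topspace_letters by simp
    \<comment> \<open>Words of length below two are padded with the neutral letter.\<close>
    have "\<exists>p\<in>topspace \<L>. \<exists>q\<in>topspace \<L>. w = foldr push (snd p) (snd q)"
    proof (cases w)
      case Nil
      then show ?thesis using e by (intro bexI[of _ "(2, [])"]) auto
    next
      case l: (Cons l v)
      then have x: "fst l \<in> topspace X" using w by (auto simp: FP_upto_def)
      show ?thesis
      proof (cases v)
        case Nil
        then show ?thesis using e l letter[OF x, of "snd l"] letter_in_letters[OF x, of "snd l"]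
          by (intro bexI[of _ "letter l", OF bexI[of _ "(2, [])"]]) (auto simp: push_def)
      next
        case k: (Cons k v')
        then have v: "v' = []" and y: "fst k \<in> topspace X" "k \<noteq> flip l"
          using w l by (auto simp: FP_upto_def)
        then show ?thesis using l k x letter[OF x, of "snd l"] letter[OF y(1), of "snd k"]
          letter_in_letters[OF x, of "snd l"] letter_in_letters[OF y(1), of "snd k"]
          by (intro bexI[of _ "letter l", OF bexI[of _ "letter k"]]) (auto simp: push_def)
      qed
    qed
    then show "w \<in> i2 (free_group (topspace X)) ` (topspace \<L> \<times> topspace \<L>)"
      by (force simp: i2_apply image_iff)
  qed
  have pair: "nbhd_into (snd (letter (x, b)) \<otimes>\<^bsub>free_group (topspace X)\<^esub> snd (letter (y, c))) U"
    if xy: "x \<in> topspace X" "y \<in> topspace X" "(y, c) \<noteq> flip (x, b)"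
      and U: "fibre_nbhd (snd (letter (x, b)) \<otimes>\<^bsub>free_group (topspace X)\<^esub> snd (letter (y, c))) U" for x b y c U
  proof -
    let ?w = "snd (letter (x, b)) \<otimes>\<^bsub>free_group (topspace X)\<^esub> snd (letter (y, c))"
    have w: "?w = push (x, b) [(y, c)]" using xy by (simp add: letter)
    have U': "openin (prod_topology \<L> \<L>) U" using U by (simp add: fibre_nbhd_def)
    have "(letter (x, b), letter (y, c)) \<in> U"
      using xy by (intro fibre_nbhdD[OF U]) simp_all
    then obtain A B where AB: "openin X A" "x \<in> A" "openin X B" "y \<in> B"
      "letter_nbhd A (x, b) \<times> letter_nbhd B (y, c) \<subseteq> U"
      using xy(1,2) by (rule ex_pair_nbhd[OF U'])
    obtain W0 where W0: "openin T W0" "?w \<in> W0"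
      "\<And>p q. \<lbrakk>p \<in> topspace \<L>; q \<in> topspace \<L>; snd p \<otimes>\<^bsub>free_group (topspace X)\<^esub> snd q \<in> W0\<rbrakk> \<Longrightarrow>
         (p, q) \<in> letter_nbhd A (x, b) \<times> letter_nbhd B (y, c) \<union> letter_nbhd B (y, c) \<times> letter_nbhd A (x, b)"
      using neighbourhood_pair_mem[OF t1 xy AB(1-4)] by blast
    \<comment> \<open>The Abelian tests give \<^term>\<open>W0\<close>, on which the two letters are determined up to their order;
      the sets \<open>A'\<close> and \<open>B'\<close> exclude the wrong order.\<close>
    define A' where "A' = (if b then A else topspace X - {x})"
    define B' where "B' = (if c then B else topspace X - {y})"
    have "openin X A'" "openin X B'"
      using AB t1 xy by (auto simp: A'_def B'_def t1_space_closedin_singleton)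
    obtain W1 where W1: "openin T W1" "push (x, b) [(y, c)] \<in> W1"
      "\<And>z s t u. \<lbrakk>z \<in> topspace X; t \<in> topspace X; push (z, s) [(t, u)] \<in> W1\<rbrakk> \<Longrightarrow>
         push (z \<in> A', s) [(t \<in> A', u)] = push (x \<in> A', b) [(y \<in> A', c)] \<or>
         letter_value (x \<in> A', b) + letter_value (y \<in> A', c) < letter_value (z \<in> A', s) + letter_value (t \<in> A', u)"
      using FP_order_neighbourhood[OF FP \<open>openin X A'\<close> xy(1,2)] by blast
    obtain W2 where W2: "openin T W2" "push (x, b) [(y, c)] \<in> W2"
      "\<And>z s t u. \<lbrakk>z \<in> topspace X; t \<in> topspace X; push (z, s) [(t, u)] \<in> W2\<rbrakk> \<Longrightarrow>
         push (z \<in> B', s) [(t \<in> B', u)] = push (x \<in> B', b) [(y \<in> B', c)] \<or>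
         letter_value (x \<in> B', b) + letter_value (y \<in> B', c) < letter_value (z \<in> B', s) + letter_value (t \<in> B', u)"
      using FP_order_neighbourhood[OF FP \<open>openin X B'\<close> xy(1,2)] by blast
    have "(p, q) \<in> U"
      if pq: "p \<in> topspace \<L>" "q \<in> topspace \<L>" "snd p \<otimes>\<^bsub>free_group (topspace X)\<^esub> snd q \<in> W0 \<inter> W1 \<inter> W2" for p q
    proof -
      have "(p, q) \<in> letter_nbhd A (x, b) \<times> letter_nbhd B (y, c)"
        if swap: "(p, q) \<in> letter_nbhd B (y, c) \<times> letter_nbhd A (x, b)"
      proof -
        obtain z where z: "p = letter (z, c)" "if c then z \<in> B else z = y"
          using swap by (auto simp: letter_nbhd_def split: if_splits)
        obtain t where t: "q = letter (t, b)" "if b then t \<in> A else t = x"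
          using swap by (auto simp: letter_nbhd_def split: if_splits)
        have zt: "z \<in> topspace X" "t \<in> topspace X"
          using z t xy openin_subset[OF AB(1)] openin_subset[OF AB(3)] by (auto split: if_splits)
        then have "push (z, c) [(t, b)] \<in> W1" "push (z, c) [(t, b)] \<in> W2"
          using pq(3) by (auto simp: z t letter)
        note order = W1(3)[OF zt this(1)] W2(3)[OF zt this(2)]
        \<comment> \<open>If the signs differ, the test set omitting the point of the inverse letter
          gives a different pattern of no larger value, so the swap is impossible. If they agree,
          the tests put \<open>z\<close> and \<open>t\<close> where unswapped letters belong; for
          two inverse letters this forces \<open>x = y\<close>.\<close>
        show ?thesis
          using order xy z t zt AB(2,4)
          by (cases b; cases c) (auto simp: A'_def B'_def letter_nbhd_def push_def flip_def split: if_splits)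
      qed
      then show ?thesis using W0(3)[OF pq(1,2)] pq(3) AB(5) by blast
    qed
    moreover have "openin T (W0 \<inter> W1 \<inter> W2)" "?w \<in> W0 \<inter> W1 \<inter> W2"
      using W0 W1 W2 w by auto
    ultimately show ?thesis unfolding nbhd_into_def by blast
  qed
  have "closed_map (prod_topology \<L> \<L>) (subtopology T (FP_upto 2 X)) (i2 (free_group (topspace X)))"
    if "all_normal X"
    using t1 that two pair by (rule all_normal_imp_closed)
  then show "quotient_map (prod_topology \<L> \<L>) (subtopology T (FP_upto 2 X)) (i2 (free_group (topspace X)))
      \<longleftrightarrow> all_normal X"
    and "closed_map (prod_topology \<L> \<L>) (subtopology T (FP_upto 2 X)) (i2 (free_group (topspace X)))
      \<longleftrightarrow> all_normal X"
    using quotient_imp_all_normal closed_imp_quotient[OF two] by blast+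
qed


section \<open>Equivalence of the four conditions through normality\<close>

theorem theorem3p11:
  fixes X :: "'a topology"
    and TF :: "('a \<times> bool) list topology"
    and TA :: "('a \<Rightarrow>\<^sub>0 int) topology"
  assumes "t1_space X"
    and "is_FP X TF"
    and "is_AP X TA"
  shows
   "(quotient_map (prod_topology (FP_letters X TF) (FP_letters X TF))
        (subtopology TF (FP_upto 2 X)) (i2 (free_group (topspace X)))
     \<longleftrightarrow>
     quotient_map (prod_topology (AP_letters X TA) (AP_letters X TA))
        (subtopology TA (AP_upto 2 X)) (i2 (free_Abelian_group (topspace X))))
    \<and>
    (quotient_map (prod_topology (AP_letters X TA) (AP_letters X TA))
        (subtopology TA (AP_upto 2 X)) (i2 (free_Abelian_group (topspace X)))
     \<longleftrightarrow>
     closed_map (prod_topology (FP_letters X TF) (FP_letters X TF))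
        (subtopology TF (FP_upto 2 X)) (i2 (free_group (topspace X))))
    \<and>
    (closed_map (prod_topology (FP_letters X TF) (FP_letters X TF))
        (subtopology TF (FP_upto 2 X)) (i2 (free_group (topspace X)))
     \<longleftrightarrow>
     closed_map (prod_topology (AP_letters X TA) (AP_letters X TA))
        (subtopology TA (AP_upto 2 X)) (i2 (free_Abelian_group (topspace X))))"
  using FP_equivalence[OF assms(1,2)] AP_equivalence[OF assms(1,3)] by blast

end
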